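(* Let $X,Y$ be log-concave uncorrelated real random variables. Then $$\mathcal{N}(X+Y)\ \leq\ \frac{2\pi}{e}\left(\mathcal{N}(X)+\mathcal{N}(Y)\right).$$
   Context: A real random variable $X$ is log-concave if it has a density (with respect to Lebesgue measure) of the form $f=e^{-V}$, where $V:\mathbb{R}\to(-\infty,\infty]$ is convex. For a real random variable $X$ with density $f$, the differential entropy is $h(X)=-\int f\log f$, with $\log$ the natural logarithm and $0\log0=0$; the entropy power is $\mathcal{N}(X)=\frac{1}{2\pi e}\exp(2h(X))$. If a random variable has no density, the usual convention $h=-\infty$, $\mathcal{N}=0$ is used. $X$ and $Y$ are defined on a common probability space, and uncorrelated means $\operatorname{Cov}(X,Y)=0$ (independence is not assumed). *)

theory Defs
  imports "HOL-Probability.Probability"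
begin

text \<open>The exponential function extended to the extended reals, with
  \<open>exp (-\<infinity>) = 0\<close> and \<open>exp \<infinity> = \<infinity>\<close>.\<close>

definition exp_ext :: "ereal \<Rightarrow> ennreal" where
  "exp_ext x = (case x of ereal r \<Rightarrow> ennreal (exp r) | PInfty \<Rightarrow> \<infinity> | MInfty \<Rightarrow> 0)"

lemma exp_ext_simps [simp]:
  "exp_ext (ereal r) = ennreal (exp r)" "exp_ext \<infinity> = \<infinity>" "exp_ext (-\<infinity>) = 0"
  by (simp_all add: exp_ext_def)

text \<open>Convexity of functions with values in \<open>(-\<infinity>, \<infinity>]\<close>. As \<open>-\<infinity>\<close> is excluded, the sum on the
  right-hand side is never of the form \<open>\<infinity> - \<infinity>\<close>; where a weight vanishes, \<open>0 * \<infinity> = 0\<close>.\<close>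

definition convex_ext :: "(real \<Rightarrow> ereal) \<Rightarrow> bool" where
  "convex_ext V \<longleftrightarrow> (\<forall>x. V x \<noteq> -\<infinity>) \<and>
    (\<forall>x y u v. 0 \<le> u \<longrightarrow> 0 \<le> v \<longrightarrow> u + v = 1 \<longrightarrow>
      V (u * x + v * y) \<le> ereal u * V x + ereal v * V y)"

definition log_concave_rv :: "'a measure \<Rightarrow> ('a \<Rightarrow> real) \<Rightarrow> bool" where
  "log_concave_rv M X \<longleftrightarrow>
    (\<exists>V. convex_ext V \<and> distributed M lborel X (\<lambda>x. exp_ext (- V x)))"

text \<open>The Bochner integral is \<open>0\<close> for non-integrable functions, so \<open>- \<integral> f log f\<close> is taken as the
  difference of the integrals of the positive and the negative part of \<open>- f log f\<close>; this allows
  the values \<open>\<infinity>\<close> and \<open>-\<infinity>\<close>. If both parts have infinite integral, the entropy is undefined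
  in the usual sense and the value here is the meaningless \<open>\<infinity> - \<infinity> = \<infinity>\<close> of \<^typ>\<open>ereal\<close>;
  this does not happen for a density with finite second moment, whose positive part is always
  finite. \<open>0 log 0 = 0\<close> holds.\<close>

definition density_entropy :: "(real \<Rightarrow> real) \<Rightarrow> ereal" where
  "density_entropy f =
    enn2ereal (\<integral>\<^sup>+ x. ennreal (- (f x * ln (f x))) \<partial>lborel) -
    enn2ereal (\<integral>\<^sup>+ x. ennreal (f x * ln (f x)) \<partial>lborel)"

definition diff_entropy :: "'a measure \<Rightarrow> ('a \<Rightarrow> real) \<Rightarrow> ereal" where
  "diff_entropy M X =
    (if \<exists>f. distributed M lborel X f
     then density_entropy (\<lambda>x. enn2real (RN_deriv lborel (distr M lborel X) x))
     else -\<infinity>)"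

definition entropy_power :: "'a measure \<Rightarrow> ('a \<Rightarrow> real) \<Rightarrow> ennreal" where
  "entropy_power M X = ennreal (1 / (2 * pi * exp 1)) * exp_ext (2 * diff_entropy M X)"

definition covariance :: "'a measure \<Rightarrow> ('a \<Rightarrow> real) \<Rightarrow> ('a \<Rightarrow> real) \<Rightarrow> real" where
  "covariance M X Y =
    (\<integral>\<omega>. (X \<omega> - (\<integral>\<omega>'. X \<omega>' \<partial>M)) * (Y \<omega> - (\<integral>\<omega>'. Y \<omega>' \<partial>M)) \<partial>M)"

text \<open>The entropy does not depend on the choice of the density, and it agrees with the
  library's \<open>entropy\<close> (to the base \<open>e\<close>) whenever \<open>f log f\<close> is integrable.\<close>

lemma diff_entropy_distributed:
  assumes D: "distributed M lborel X (\<lambda>x. ennreal (f x))" and nn: "\<And>x. 0 \<le> f x"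
  shows "diff_entropy M X = density_entropy f"
proof -
  have m: "(\<lambda>x. ennreal (f x)) \<in> borel_measurable lborel"
    and eq: "density lborel (\<lambda>x. ennreal (f x)) = distr M lborel X"
    using D by (auto simp: distributed_def)
  have "AE x in lborel. ennreal (f x) = RN_deriv lborel (distr M lborel X) x"
    by (rule sigma_finite_measure.RN_deriv_unique[OF lborel.sigma_finite_measure_axioms m eq])
  then have ae: "AE x in lborel. enn2real (RN_deriv lborel (distr M lborel X) x) = f x"
    by eventually_elim (metis enn2real_ennreal nn)
  have "(\<integral>\<^sup>+ x. ennreal (- (enn2real (RN_deriv lborel (distr M lborel X) x) *
            ln (enn2real (RN_deriv lborel (distr M lborel X) x)))) \<partial>lborel) =
        (\<integral>\<^sup>+ x. ennreal (- (f x * ln (f x))) \<partial>lborel)"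
    by (rule nn_integral_cong_AE) (use ae in eventually_elim, simp)
  moreover have "(\<integral>\<^sup>+ x. ennreal (enn2real (RN_deriv lborel (distr M lborel X) x) *
            ln (enn2real (RN_deriv lborel (distr M lborel X) x))) \<partial>lborel) =
        (\<integral>\<^sup>+ x. ennreal (f x * ln (f x)) \<partial>lborel)"
    by (rule nn_integral_cong_AE) (use ae in eventually_elim, simp)
  ultimately show ?thesis
    using D by (auto simp: diff_entropy_def density_entropy_def)
qed

lemma (in prob_space) diff_entropy_eq_entropy:
  assumes D: "distributed M lborel X (\<lambda>x. ennreal (f x))" and nn: "\<And>x. 0 \<le> f x"
    and int: "integrable lborel (\<lambda>x. f x * ln (f x))"
  shows "diff_entropy M X = ereal (entropy (exp 1) lborel X)"
proof -
  interpret information_space M "exp 1"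
    by unfold_locales simp
  have log_ln: "log (exp 1) y = ln y" for y :: real
    by (simp add: log_def)
  have "entropy (exp 1) lborel X = - (\<integral>x. f x * ln (f x) \<partial>lborel)"
    using entropy_distr[OF D] nn by (simp add: log_ln)
  moreover have "(\<integral>x. f x * ln (f x) \<partial>lborel) =
      enn2real (\<integral>\<^sup>+ x. ennreal (f x * ln (f x)) \<partial>lborel) -
      enn2real (\<integral>\<^sup>+ x. ennreal (- (f x * ln (f x))) \<partial>lborel)"
    by (rule real_lebesgue_integral_def[OF int])
  moreover have "(\<integral>\<^sup>+ x. ennreal (f x * ln (f x)) \<partial>lborel) \<noteq> \<infinity>"
    "(\<integral>\<^sup>+ x. ennreal (- (f x * ln (f x))) \<partial>lborel) \<noteq> \<infinity>"
    using int by (auto simp: real_integrable_def)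
  ultimately show ?thesis
    unfolding diff_entropy_distributed[OF D nn] density_entropy_def
    by (cases "\<integral>\<^sup>+ x. ennreal (f x * ln (f x)) \<partial>lborel";
        cases "\<integral>\<^sup>+ x. ennreal (- (f x * ln (f x))) \<partial>lborel") (auto simp: enn2ereal_ennreal)
qed

end

theory Submission
  imports Defs "HOL-Real_Asymp.Real_Asymp"
begin

text \<open>Both sides of the inequality are compared with the variance of \<open>X + Y\<close>. Among all laws with a
  given variance the Gaussian has the largest entropy, so \<open>N(X + Y) \<le> Var (X + Y)\<close>, and
  \<open>Var (X + Y) = Var X + Var Y\<close> because the variables are uncorrelated. What remains is a sharp
  reverse inequality for one log-concave variable,
  \<open>Var X \<le> exp (2 h(X) - 2) = (2 pi / e) N(X)\<close>, an equality for exponential laws; this is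
  \<open>log_concave_density.variance_entropy\<close>.

  For its proof the density \<open>f\<close> is cut at its mode. On the right half let \<open>S\<close> be the tail mass,
  take \<open>p = S x\<close> as the variable, and write \<open>\<theta> p = S x / f x\<close> for the Mills ratio. Log-concavity
  makes \<open>\<theta>\<close> nondecreasing (the hazard rate increases), and monotonicity of \<open>f\<close> makes
  \<open>\<theta> p / p = 1 / f x\<close> nonincreasing. Mean, variance and entropy of the half are expressed through the
  integrals of \<open>\<theta>\<close>, of the squared running mean of \<open>\<theta>\<close>, and of \<open>ln \<theta>\<close>. Two estimates hold for such profiles:

  \<^item> \<open>variance_le\<close>: the variance is at most \<open>exp\<close> of twice the mean of \<open>ln \<theta>\<close>. This is the
    one-sided case of the theorem. It is proved by conditioning on \<open>X > x\<close> and letting \<open>x\<close> decrease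
    from the end of the support: the deficit in the inequality, weighted by the tail mass, changes
    monotonically, by an inequality between two moments and the density at the cut.
  \<^item> \<open>F_le\<close>: an upper bound for the mean that is linear in the entropy.

  If both halves carry mass, they share the same peak height. The variance of the whole density is
  expressed by the masses, means and variances of the halves, and after inserting the two
  estimates one is left with an inequality between real numbers, \<open>two_sided_scalar\<close>.\<close>

section \<open>Scalar inequalities\<close>

lemma ln_le_half_diff_inverse: fixes t :: real assumes "t \<ge> 1" shows "ln t \<le> (t - 1/t)/2"
proof -
  have "0 - 0 \<le> (t - 1/t)/2 - ln t"
  proof -
    have "\<exists>y. ((\<lambda>t::real. (t - 1/t)/2 - ln t) has_real_derivative y) (at x) \<and> y \<ge> 0" if "1 \<le> x" "x \<le> t" for x
    proof (intro exI conjI)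
      show "((\<lambda>t::real. (t - 1/t)/2 - ln t) has_real_derivative (1 - 1/x)^2/2) (at x)"
        using that by (auto intro!: derivative_eq_intros simp: field_simps power2_eq_square)
    qed simp
    from DERIV_nonneg_imp_nondecreasing[OF assms this] show ?thesis by simp
  qed
  then show ?thesis by simp
qed

lemma ln_ge_pade: fixes w :: real assumes "w \<ge> 1" shows "2*(w-1)/(w+1) \<le> ln w"
proof -
  have "\<exists>y. ((\<lambda>t::real. ln t - 2*(t-1)/(t+1)) has_real_derivative y) (at x) \<and> y \<ge> 0" if "1 \<le> x" "x \<le> w" for x
  proof (intro exI conjI)
    show "((\<lambda>t::real. ln t - 2*(t-1)/(t+1)) has_real_derivative (1/x - 4/(x+1)^2)) (at x)"
      using that by (auto intro!: derivative_eq_intros simp: field_simps power2_eq_square)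
    have "1/x - 4/(x+1)^2 = (x-1)^2/(x*(x+1)^2)"
      using that by (simp add: divide_simps) (simp add: algebra_simps power2_eq_square)
    then show "1/x - 4/(x+1)^2 \<ge> 0" using that by simp
  qed
  from DERIV_nonneg_imp_nondecreasing[OF assms this] show ?thesis by simp
qed

lemma ln_one_minus_upper: fixes z :: real assumes "0 \<le> z" "z < 1" shows "ln (1 - z) \<le> - z - z^2/2"
proof -
  have "\<exists>y. ((\<lambda>t::real. - t - t^2/2 - ln (1 - t)) has_real_derivative y) (at x) \<and> y \<ge> 0" if "0 \<le> x" "x \<le> z" for x
  proof (intro exI conjI)
    show "((\<lambda>t::real. - t - t^2/2 - ln (1 - t)) has_real_derivative (x^2/(1-x))) (at x)"
      using that assms by (auto intro!: derivative_eq_intros simp: field_simps power2_eq_square)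
    show "x^2/(1-x) \<ge> 0" using that assms by simp
  qed
  from DERIV_nonneg_imp_nondecreasing[OF assms(1) this] show ?thesis by simp
qed

lemma one_plus_mult_exp_le: fixes x :: real assumes "0 \<le> x" "x \<le> 1" shows "(1 + x) * exp (1 - x) \<le> 3 - x"
proof -
  define y where "y = 1 - x"
  have y: "0 \<le> y" "y \<le> 1" using assms by (auto simp: y_def)
  have "\<exists>d. ((\<lambda>t::real. 2 + t - (2 - t)*exp t) has_real_derivative d) (at u) \<and> d \<ge> 0" if "0 \<le> u" "u \<le> y" for u
  proof (intro exI conjI)
    show "((\<lambda>t::real. 2 + t - (2 - t)*exp t) has_real_derivative (1 - (1 - u)*exp u)) (at u)"
      by (auto intro!: derivative_eq_intros simp: field_simps)
    have "1 - u \<le> exp (-u)" using exp_ge_add_one_self[of "-u"] by simp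
    then show "1 - (1 - u)*exp u \<ge> 0" by (simp add: exp_minus field_simps)
  qed
  from DERIV_nonneg_imp_nondecreasing[OF y(1) this] show ?thesis by (simp add: y_def)
qed

lemma one_minus_mult_exp_le: fixes b :: real assumes "0 \<le> b" shows "(1 - b) * exp b \<le> 1 - b^2/2"
proof -
  have "\<exists>d. ((\<lambda>t::real. 1 - t^2/2 - (1 - t)*exp t) has_real_derivative d) (at u) \<and> d \<ge> 0" if "0 \<le> u" "u \<le> b" for u
  proof (intro exI conjI)
    show "((\<lambda>t::real. 1 - t^2/2 - (1 - t)*exp t) has_real_derivative (u * (exp u - 1))) (at u)"
      by (auto intro!: derivative_eq_intros simp: field_simps)
    show "u * (exp u - 1) \<ge> 0" using that by simp
  qed
  from DERIV_nonneg_imp_nondecreasing[OF assms this] show ?thesis by simp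
qed

text \<open>The difference of the two sides is a polynomial of degree 9 in \<open>y\<close> whose coefficients in the
  Bernstein basis of that degree are all positive. Everything is multiplied by 576 so that the
  comparison of coefficients takes place between integers.\<close>
lemma residual_polynomial_bound:
  fixes y :: real
  assumes "0 \<le> y" "y \<le> 1"
  defines "k \<equiv> 1 - y/3 - y^2 + y^3/2"
  defines "R \<equiv> (1 - y^2/2)^2"
  shows "k^2 \<le> (R - y*k) * (2*R - y*k) * (1 + y^2/4)"
proof -
  have k: "12 * k = 12 - 4*y - 12*y^2 + 6*y^3" and R: "12 * R = 3 * (2 - y^2)^2"
    by (simp_all add: k_def R_def power2_eq_square field_simps)
  have "576 * ((R - y*k) * (2*R - y*k) * (1 + y^2/4) - k^2) =
      (12*R - y*(12*k)) * (2*(12*R) - y*(12*k)) * (4 + y^2) - 4 * (12*k)^2"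
    by (simp add: field_simps power2_eq_square)
  also have "\<dots> = 4 * (144 - 336*y + 56*y^2 + 420*y^3 - 368*y^4 + 36*y^5 + 118*y^6 - 111*y^7
      + 51*y^8 - 9*y^9)"
    unfolding k R by (simp add: power_numeral_reduce algebra_simps)
  also have "\<dots> = 4 * (144*(1-y)^9 + 960*y*(1-y)^8 + 2552*y^2*(1-y)^7 + 3500*y^3*(1-y)^6
      + 2656*y^4*(1-y)^5 + 1080*y^5*(1-y)^4 + 222*y^6*(1-y)^3 + 31*y^7*(1-y)^2 + 7*y^8*(1-y) + y^9)"
    by (simp add: power_numeral_reduce algebra_simps)
  also have "\<dots> \<ge> 0"
    using assms by (intro mult_nonneg_nonneg add_nonneg_nonneg zero_le_power) auto
  finally show ?thesis by simp
qed

text \<open>In the application \<open>r = 1 - s/2\<close> and \<open>v\<close> are the mean and the variance of a law on the half-line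
  whose decreasing density starts with the value 1. As \<open>ln v + r\<^sup>2 / v\<close> decreases in \<open>v\<close> on
  \<open>(0, r\<^sup>2]\<close>, small variances are critical, and the lower bound on \<open>v\<close> is needed. With
  \<open>w = r\<^sup>2 / v\<close> the claim reads \<open>w - 1 - ln w \<le> - 2 ln r\<close>. Rational bounds of the logarithms
  turn it into an algebraic inequality, and the substitution \<open>s = y\<^sup>2\<close> makes that polynomial, since
  \<open>- s ln s \<le> y - y\<^sup>3\<close>.\<close>
lemma lower_variance_scalar:
  fixes s v :: real
  assumes s: "0 \<le> s" "s \<le> 1" and v0: "0 < v" and vr: "v \<le> (1 - s/2)^2"
    and vs: "1 - 2 * s / 3 + s * ln s - s^2/4 \<le> v"
  shows "ln v + (1 - s/2)^2 / v \<le> 1"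
proof -
  define y where "y = sqrt s"
  have y: "0 \<le> y" "y \<le> 1" "s = y^2" using s by (auto simp: y_def)
  define k where "k = 1 - y/3 - y^2 + y^3/2"
  define R where "R = (1 - y^2/2)^2"
  have R: "R = (1 - s/2)^2" by (simp add: R_def y)
  have "R - y * k \<le> v"
  proof (cases "s = 0")
    case True then show ?thesis using vs y by (simp add: R_def)
  next
    case False
    then have y0: "y > 0" using y by (cases "y = 0") auto
    have "ln (1/y) \<le> (1/y - y)/2" using ln_le_half_diff_inverse[of "1/y"] y0 y by simp
    then have "- ln y \<le> (1/y - y)/2" using y0 by (simp add: ln_div)
    then have "2 * y^2 * (- ln y) \<le> 2 * y^2 * ((1/y - y)/2)" by (intro mult_left_mono) auto
    also have "\<dots> = y - y^3" using y0 by (simp add: field_simps power2_eq_square power3_eq_cube)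
    finally have "y^3 - y \<le> s * ln s" using y0 y by (simp add: ln_realpow)
    moreover have "R - y * k = 1 - 2 * s / 3 + (y^3 - y) - s^2/4"
      by (simp add: R_def k_def y(3) power2_eq_square power3_eq_cube field_simps)
    ultimately show ?thesis using vs by linarith
  qed
  \<comment> \<open>positive coefficients in the Bernstein basis of degree 4\<close>
  have low_pos: "0 \<le> R - y * k"
  proof -
    have "R - y * k = (1-y)^4 + 3*y*(1-y)^3 + 7/3*y^2*(1-y)^2 + 2/3*y^3*(1-y) + 1/12*y^4"
      by (simp add: R_def k_def power_numeral_reduce field_simps)
    also have "\<dots> \<ge> 0" using y by (intro add_nonneg_nonneg mult_nonneg_nonneg zero_le_power) auto
    finally show ?thesis .
  qed
  define w where "w = R / v"
  have w1: "w \<ge> 1" using v0 vr R by (simp add: w_def)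
  have Rk: "R - v \<le> y * k" using \<open>R - y * k \<le> v\<close> by simp
  have Rpos: "R > 0" "v \<le> R" using s v0 vr by (auto simp: R)
  have yk: "0 \<le> y * k" using Rk Rpos by linarith
  have cert: "k^2 \<le> (R - y*k) * (2*R - y*k) * (1 + y^2/4)"
    using residual_polynomial_bound[OF y(1,2)] unfolding k_def R_def .
  have "(R - v)^2 \<le> (y*k)^2" using Rk Rpos by (intro power_mono) auto
  also have "\<dots> \<le> y^2 * ((R - y*k) * (2*R - y*k) * (1 + y^2/4))"
    using cert by (simp add: power_mult_distrib mult_left_mono)
  also have "\<dots> \<le> y^2 * (v * (R + v) * (1 + y^2/4))"
  proof -
    have "(R - y*k) * (2*R - y*k) \<le> v * (R + v)"
      using \<open>R - y * k \<le> v\<close> v0 Rpos low_pos by (intro mult_mono) auto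
    then show ?thesis using y by (intro mult_left_mono mult_right_mono) auto
  qed
  finally have main: "(R - v)^2 \<le> s * (1 + s/4) * (v * (R + v))" by (simp add: y algebra_simps)
  have "w - 1 - ln w \<le> (w - 1)^2/(w + 1)"
    using ln_ge_pade[OF w1] w1 by (simp add: field_simps power2_eq_square)
  also have "\<dots> = (R - v)^2 / (v * (R + v))"
    using v0 Rpos by (simp add: w_def divide_simps) (simp add: algebra_simps power2_eq_square)
  also have "\<dots> \<le> s * (1 + s/4)" using main v0 Rpos by (simp add: divide_le_eq)
  also have "\<dots> \<le> - 2 * ln (1 - s/2)"
    using ln_one_minus_upper[of "s/2"] s by (simp add: field_simps power2_eq_square)
  also have "\<dots> = - ln R" using s by (simp add: R ln_realpow)
  finally have "w - ln w + ln R \<le> 1" by simp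
  moreover have "ln w = ln R - ln v" using v0 Rpos by (simp add: w_def ln_div)
  ultimately show ?thesis by (simp add: w_def R)
qed

lemma convex_exp_endpoints:
  fixes c h :: real assumes "0 \<le> h" "h \<le> 1"
  shows "exp (c * h) \<le> (1 - h) + h * exp c"
proof -
  have "exp ((1 - h) *\<^sub>R 0 + h *\<^sub>R c) \<le> (1 - h) * exp 0 + h * exp c"
    by (rule convex_onD[OF exp_convex]) (use assms in auto)
  then show ?thesis by (simp add: mult.commute)
qed

text \<open>With \<open>d = h - k\<close> and \<open>m = a h + b k\<close> the claim divided by its right-hand side involves
  \<open>m\<close> only through \<open>(1 + m) exp (1 - m)\<close>. This is at most \<open>3 - m\<close>, hence at most \<open>3 - a d\<close>. The
  resulting bound is convex in \<open>d\<close>, so only \<open>d = 0\<close> and \<open>d = 1\<close> remain.\<close>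
lemma two_sided_scalar_aux:
  fixes a b h k :: real
  assumes a: "0 \<le> a" "0 \<le> b" "a + b = 1" and h: "h \<le> 1" and k: "0 \<le> k" and kh: "k \<le> h"
  shows "a^3 * exp (2*h) + b^3 * exp (2*k) + a*b * (exp 1 * (a*(1+h)/2 + b*(1+k)/2))^2 \<le> exp (2*(a*h + b*k))"
proof -
  define d where "d = h - k"
  define m where "m = a*h + b*k"
  have d: "0 \<le> d" "d \<le> 1" using assms by (auto simp: d_def)
  have hm: "h = m + b*d" and km: "k = m - a*d"
  proof -
    have b: "b = 1 - a" using a by simp
    show "h = m + b*d" "k = m - a*d" by (simp_all add: m_def d_def b algebra_simps)
  qed
  have m: "a*d \<le> m" "m \<le> 1" "0 \<le> m"
  proof -
    show "a*d \<le> m" using km k by simp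
    have "m \<le> a*1+b*1" unfolding m_def using assms by (intro add_mono mult_left_mono) auto
    then show "m \<le> 1" using a by simp
    show "0 \<le> m" using \<open>a*d \<le> m\<close> a d by (meson mult_nonneg_nonneg order_trans)
  qed
  have lin: "a*(1+h)/2 + b*(1+k)/2 = (1 + m)/2" using a by (simp add: m_def field_simps)
  have "exp 1 * ((1 + m)/2) = exp m * ((1 + m) * exp (1 - m) / 2)" by (simp add: exp_diff)
  also have "\<dots> \<le> exp m * ((3 - m) / 2)" using one_plus_mult_exp_le[of m] m by (intro mult_left_mono) auto
  also have "\<dots> \<le> exp m * ((3 - a*d) / 2)" using m by (intro mult_left_mono) auto
  finally have e1: "(exp 1 * ((1 + m)/2))^2 \<le> (exp m * ((3 - a*d) / 2))^2"
    using m by (intro power_mono) auto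
  have conv: "((3 - a*d)/2)^2 \<le> (1 - d) * (9/4) + d * ((3 - a)/2)^2"
  proof -
    have "(1 - d) * (9/4) + d * ((3 - a)/2)^2 - ((3 - a*d)/2)^2 = a^2 * (d * (1 - d)) / 4" by (simp add: power2_eq_square power3_eq_cube field_simps)
    moreover have "\<dots> \<ge> 0" using d by simp
    ultimately show ?thesis by linarith
  qed
  \<comment> \<open>the value of the convex bound at \<open>d = 1\<close>\<close>
  define X where "X = a^3 * exp (2*b) + b^3 * exp (-(2*a)) + a*b*((3 - a)/2)^2"
  have b1: "a = 1 - b" "b \<le> 1" using a by auto
  have X: "X \<le> 1"
  proof -
    have t1: "a^3 * exp (2*b) \<le> a * (1 - b^2/2)^2"
    proof -
      have "exp (2*b) = (exp b)^2" by (simp add: exp_double)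
      then have "a^3 * exp (2*b) = a * ((1 - b) * exp b)^2" by (simp add: b1 power2_eq_square power3_eq_cube)
      also have "\<dots> \<le> a * (1 - b^2/2)^2"
        using one_minus_mult_exp_le[OF a(2)] a b1 by (intro mult_left_mono power_mono) auto
      finally show ?thesis .
    qed
    have "exp (-(2*a)) \<le> 1 / (1 + 2*a)"
      using exp_ge_add_one_self[of "2*a"] a by (simp add: exp_minus field_simps)
    then have t2: "b^3 * exp (-(2*a)) \<le> b^3 * (1 / (1 + 2*a))" using a by (intro mult_left_mono) auto
    have pol: "a * (1 - b^2/2)^2 + a*b*((3 - a)/2)^2 = 1 - b^2 * (1 - a * (b + b^2)/4)"
      unfolding b1(1) by (simp add: power2_eq_square power3_eq_cube field_simps)
    have "b * (a * (1 + b) / 4 + 1/(1+2*a)) \<le> 1"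
    proof -
      have "b * (a * (1 + b)/4 * (1 + 2*a) + 1) \<le> b * (a/2*(1+2*a) + 1)"
        using a b1 by (intro mult_left_mono add_mono mult_right_mono) (auto simp: field_simps mult_left_le)
      also have "\<dots> \<le> 1 + 2*a"
      proof -
        have "(1 + 2*a) - (1-a) * (a/2*(1+2*a) + 1) = 5/2*a - a^2/2 + a^3" by (simp add: power2_eq_square power3_eq_cube field_simps)
        moreover have "a^2 \<le> a" using a b1 by (simp add: power2_eq_square mult_left_le)
        moreover have "0 \<le> a^3" using a by simp
        ultimately have "0 \<le> (1 + 2*a) - (1-a) * (a/2*(1+2*a) + 1)" using a by linarith
        moreover have "b = 1 - a" using a by simp
        ultimately show ?thesis by (metis diff_ge_0_iff_ge)
      qed
      finally show ?thesis using a by (simp add: field_simps)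
    qed
    then have "b^2 * (b * (a * (1 + b) / 4 + 1/(1+2*a))) \<le> b^2 * 1" by (intro mult_left_mono) auto
    then have "b^3 * (1/(1+2*a)) \<le> b^2 * (1 - a*(b+b^2)/4)"
      by (simp add: algebra_simps power2_eq_square power3_eq_cube)
    then show ?thesis using t1 t2 pol unfolding X_def by linarith
  qed
  have e2: "exp (2*b*d) \<le> (1 - d) + d * exp (2*b)" using convex_exp_endpoints[OF d, of "2*b"] by simp
  have e3: "exp (-(2*a*d)) \<le> (1 - d) + d * exp (-(2*a))" using convex_exp_endpoints[OF d, of "-(2*a)"] by simp
  have "a^3 * exp (2*b*d) + b^3 * exp (-(2*a*d)) + a*b*((3 - a*d)/2)^2
     \<le> a^3 * ((1 - d) + d * exp (2*b)) + b^3 * ((1 - d) + d * exp (-(2*a))) + a*b*((1 - d) * (9/4) + d * ((3 - a)/2)^2)"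
    using e2 e3 conv a by (intro add_mono mult_left_mono) auto
  also have "\<dots> = (1 - d) * (a^3 + b^3 + a*b*(9/4)) + d * X" unfolding X_def by (simp add: power2_eq_square power3_eq_cube field_simps)
  also have "a^3 + b^3 + a*b*(9/4) = 1 - 3/4 * (a*b)" unfolding b1(1) by (simp add: power2_eq_square power3_eq_cube field_simps)
  also have "(1 - d) * (1 - 3/4 * (a*b)) + d * X \<le> (1 - d) * 1 + d * 1"
    using d X a by (intro add_mono mult_left_mono) auto
  finally have fin: "a^3 * exp (2*b*d) + b^3 * exp (-(2*a*d)) + a*b*((3 - a*d)/2)^2 \<le> 1" by simp
  have "a^3 * exp (2*h) + b^3 * exp (2*k) + a*b * (exp 1 * (a*(1+h)/2 + b*(1+k)/2))^2
     \<le> a^3 * exp (2*h) + b^3 * exp (2*k) + a*b * (exp m * ((3 - a*d) / 2))^2"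
    unfolding lin using e1 a by (intro add_mono mult_left_mono) auto
  also have "\<dots> = exp (2*m) * (a^3 * exp (2*b*d) + b^3 * exp (-(2*a*d)) + a*b*((3 - a*d)/2)^2)"
  proof -
    have "2*h = 2*m + 2*b*d" "2*k = 2*m + - (2*a*d)" by (simp_all add: hm km algebra_simps)
    then have "exp (2*h) = exp (2*m) * exp (2*b*d)" "exp (2*k) = exp (2*m) * exp (-(2*a*d))"
      by (simp_all only: exp_add)
    moreover have "(exp m * c)^2 = exp (2*m) * c^2" for c :: real
      by (simp add: power_mult_distrib exp_double)
    ultimately show ?thesis by (simp only:) (simp add: algebra_simps)
  qed
  also have "\<dots> \<le> exp (2*m) * 1" using fin by (intro mult_left_mono) auto
  finally show ?thesis by (simp add: m_def)
qed

lemma two_sided_scalar: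
  fixes a b h k :: real
  assumes a: "0 \<le> a" "0 \<le> b" "a + b = 1" and "0 \<le> h" "h \<le> 1" "0 \<le> k" "k \<le> 1"
  shows "a^3 * exp (2*h) + b^3 * exp (2*k) + a*b * (exp 1 * (a*(1+h)/2 + b*(1+k)/2))^2 \<le> exp (2*(a*h + b*k))"
proof (cases "k \<le> h")
  case True then show ?thesis using two_sided_scalar_aux[of a b h k] assms by simp
next
  case False then show ?thesis using two_sided_scalar_aux[of b a k h] assms by (simp add: algebra_simps)
qed

section \<open>Profiles of Mills ratios\<close>

lemma dominated_absolutely_integrable_interval:
  fixes f g :: "real \<Rightarrow> real"
  assumes "continuous_on {c<..<d} f" "g integrable_on {c..d}"
    and "\<And>x. c < x \<Longrightarrow> x < d \<Longrightarrow> \<bar>f x\<bar> \<le> g x"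
  shows "f absolutely_integrable_on {c<..<d}" "f integrable_on {c..d}"
proof -
  show 1: "f absolutely_integrable_on {c<..<d}"
    by (rule measurable_bounded_by_integrable_imp_absolutely_integrable[where g = g])
       (use assms in \<open>auto intro!: continuous_imp_measurable_on_sets_lebesgue simp: integrable_on_open_interval_real\<close>)
  then show "f integrable_on {c..d}"
    using set_lebesgue_integral_eq_integral(1) integrable_on_open_interval_real by blast
qed

lemma has_integral_ln:
  fixes a :: real assumes "0 \<le> a"
  shows "(ln has_integral (a * ln a - a)) {0..a}"
proof -
  have "(ln has_integral ((a * ln a - a) - (0 * ln 0 - 0))) {0..a}"
  proof (rule fundamental_theorem_of_calculus_interior[OF assms])
    have "((\<lambda>x::real. x * ln x - x) \<longlongrightarrow> 0) (at_right 0)" by real_asymp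
    then have "continuous (at_right 0) (\<lambda>x::real. x * ln x - x)" by (simp add: continuous_within)
    moreover have "at (0::real) within {0..a} \<le> at_right 0"
      unfolding at_within_def by (intro inf_mono) auto
    ultimately have *: "continuous (at 0 within {0..a}) (\<lambda>x::real. x * ln x - x)"
      unfolding continuous_within by (auto intro: tendsto_mono)
    show "continuous_on {0..a} (\<lambda>x. x * ln x - x)"
      unfolding continuous_on_eq_continuous_within
    proof
      fix x assume "x \<in> {0..a}"
      then show "continuous (at x within {0..a}) (\<lambda>x. x * ln x - x)"
        using * by (cases "x = 0") (auto intro!: continuous_intros simp: continuous_at_imp_continuous_within)
    qed
    show "((\<lambda>x. x * ln x - x) has_vector_derivative ln x) (at x)" if "x \<in> {0<..<a}" for x
      using that unfolding has_real_derivative_iff_has_vector_derivative[symmetric]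
      by (auto intro!: derivative_eq_intros)
  qed
  then show ?thesis by simp
qed

text \<open>For a decreasing density \<open>f\<close> with tail mass \<open>S\<close> and total mass \<open>a\<close>, \<open>\<theta> (S x) = S x / f x\<close> is
  the Mills ratio as a function of the tail mass. Assumption \<open>mono\<close> says that the hazard rate
  \<open>f / S\<close> increases in \<open>x\<close>, and \<open>star\<close> says that \<open>f\<close> decreases. The value \<open>\<theta> 0 = 0\<close> is a
  convention that extends both assumptions to the closed interval.\<close>
locale mills_profile =
  fixes a :: real and \<theta> :: "real \<Rightarrow> real"
  assumes a: "0 < a" and zero: "\<theta> 0 = 0" and pos: "0 < p \<Longrightarrow> p \<le> a \<Longrightarrow> 0 < \<theta> p"
    and mono: "0 \<le> p \<Longrightarrow> p \<le> q \<Longrightarrow> q \<le> a \<Longrightarrow> \<theta> p \<le> \<theta> q"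
    and star: "0 \<le> p \<Longrightarrow> p \<le> q \<Longrightarrow> q \<le> a \<Longrightarrow> p * \<theta> q \<le> q * \<theta> p"
begin

text \<open>Condition a random variable with density proportional to \<open>f\<close> on exceeding the level with tail
  mass \<open>p\<close>. Then \<open>F p / p\<close> is the mean excess over that level, \<open>A p / p\<close> is the variance, and
  \<open>1 + L p / p\<close> is the entropy of the conditional law. That the variance is the mean of the squared
  mean excess follows from \<open>second_moment\<close>.\<close>
definition F where "F p = integral {0..p} \<theta>"
definition A where "A p = integral {0..p} (\<lambda>q. (F q / q)^2)"
definition L where "L p = integral {0..p} (\<lambda>q. ln (\<theta> q))"

lemma \<theta>_int: "p \<le> a \<Longrightarrow> \<theta> integrable_on {0..p}"
  by (rule integrable_on_mono_on) (auto intro!: mono_onI mono)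

lemma \<theta>_cont: "continuous_on {0<..<a} \<theta>"
proof (rule continuous_at_imp_continuous_on, rule ballI)
  fix p assume "p \<in> {0<..<a}"
  then have p: "0 < p" "p < a" by auto
  have "\<forall>\<^sub>F q in at p. q \<in> {0<..<a}"
    using p by (intro eventually_at_in_open') auto
  then have "\<forall>\<^sub>F q in at p. norm (\<theta> q - \<theta> p) \<le> \<theta> p / p * \<bar>q - p\<bar>"
  proof eventually_elim
    case (elim q)
    show ?case
    proof (cases "q \<le> p")
      case True
      then show ?thesis using mono[of q p] star[of q p] elim p by (simp add: field_simps)
    next
      case False
      then show ?thesis using mono[of p q] star[of p q] elim p by (simp add: field_simps)
    qed
  qed
  moreover have "((\<lambda>q. \<theta> p / p * \<bar>q - p\<bar>) \<longlongrightarrow> 0) (at p)"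
    using p by (auto intro!: tendsto_eq_intros)
  ultimately have "((\<lambda>q. \<theta> q - \<theta> p) \<longlongrightarrow> 0) (at p)" by (rule Lim_null_comparison)
  then show "isCont \<theta> p" by (simp add: isCont_def LIM_zero_iff)
qed

lemma \<theta>_isCont: "0 < p \<Longrightarrow> p < a \<Longrightarrow> isCont \<theta> p"
  using \<theta>_cont by (auto simp: continuous_on_eq_continuous_at)

lemma F_cont: "continuous_on {0..a} F"
  unfolding F_def by (rule indefinite_integral_continuous_1[OF \<theta>_int]) simp

lemma integral_deriv:
  fixes g :: "real \<Rightarrow> real"
  assumes "g integrable_on {0..a}" "0 < p" "p < a" "isCont g p"
  shows "((\<lambda>u. integral {0..u} g) has_real_derivative g p) (at p)"
proof -
  have "((\<lambda>u. integral {0..u} g) has_vector_derivative g p) (at p within ({0..a} - {}))"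
    by (rule integral_has_vector_derivative_continuous_at)
       (use assms in \<open>auto simp: continuous_at_imp_continuous_within\<close>)
  then show ?thesis
    using assms by (simp add: has_real_derivative_iff_has_vector_derivative at_within_Icc_at)
qed

lemma F_deriv: "0 < p \<Longrightarrow> p < a \<Longrightarrow> (F has_real_derivative \<theta> p) (at p)"
  unfolding F_def using integral_deriv[OF \<theta>_int[OF order_refl] _ _ \<theta>_isCont] .

lemma F_zero [simp]: "F 0 = 0" by (simp add: F_def)

lemma F_upper: assumes "0 \<le> p" "p \<le> a" shows "F p \<le> p * \<theta> p"
proof -
  have "F p \<le> integral {0..p} (\<lambda>_. \<theta> p)"
    unfolding F_def using assms by (intro integral_le \<theta>_int mono) auto
  then show ?thesis using assms by simp
qed

lemma F_lower: assumes "0 \<le> p" "p \<le> a" shows "p * \<theta> p / 2 \<le> F p"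
proof (cases "p = 0")
  case False
  then have p: "0 < p" using assms by simp
  have "((\<lambda>q. \<theta> p / p * q) has_integral (\<theta> p / p * ((p^2 - 0^2)/2))) {0..p}"
    using assms by (intro has_integral_mult_right ident_has_integral) auto
  then have *: "((\<lambda>q. \<theta> p / p * q) has_integral (p * \<theta> p / 2)) {0..p}"
    using p by (simp add: power2_eq_square mult.commute)
  have "p * \<theta> p / 2 = integral {0..p} (\<lambda>q. \<theta> p / p * q)" by (rule integral_unique[OF *, symmetric])
  also have "\<dots> \<le> F p"
    unfolding F_def using * assms p star by (intro integral_le \<theta>_int) (auto simp: field_simps)
  finally show ?thesis .
qed simp

lemma F_pos: "0 < p \<Longrightarrow> p \<le> a \<Longrightarrow> 0 < F p"
  using F_lower[of p] pos[of p] by (smt (verit) divide_pos_pos mult_pos_pos)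

lemma F_incr: assumes "0 \<le> q" "q \<le> p" "p \<le> a" shows "F p - (p - q) * \<theta> p \<le> F q"
proof -
  have "F q + integral {q..p} \<theta> = F p"
    unfolding F_def using assms by (intro Henstock_Kurzweil_Integration.integral_combine \<theta>_int) auto
  moreover have "integral {q..p} \<theta> \<le> integral {q..p} (\<lambda>_. \<theta> p)"
    using assms by (intro integral_le mono integrable_on_subinterval[OF \<theta>_int[of p]]) auto
  ultimately show ?thesis using assms by simp
qed

lemma mean_mono: assumes "0 < p" "p \<le> q" "q \<le> a" shows "F p / p \<le> F q / q"
proof (rule DERIV_nonneg_imp_increasing_open[OF assms(2)])
  show "continuous_on {p..q} (\<lambda>p. F p / p)"
    using assms by (intro continuous_intros continuous_on_subset[OF F_cont]) auto
  fix x assume x: "p < x" "x < q"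
  then have x': "0 < x" "x < a" using assms by auto
  have "((\<lambda>p. F p / p) has_real_derivative (\<theta> x * x - F x) / x^2) (at x)"
    using x' by (auto intro!: derivative_eq_intros F_deriv simp: power2_eq_square)
  moreover have "(\<theta> x * x - F x) / x^2 \<ge> 0" using F_upper[of x] x' by (simp add: mult.commute)
  ultimately show "\<exists>y. ((\<lambda>p. F p / p) has_real_derivative y) (at x) \<and> 0 \<le> y" by blast
qed

text \<open>The derivative has the sign of \<open>p \<theta> p - 2 F p\<close>, which \<open>F_lower\<close> controls.\<close>
lemma F_over_square_antimono: assumes "0 < p" "p \<le> q" "q \<le> a" shows "F q / q^2 \<le> F p / p^2"
proof (rule DERIV_nonpos_imp_decreasing_open[OF assms(2)])
  show "continuous_on {p..q} (\<lambda>p. F p / p^2)"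
    using assms by (intro continuous_intros continuous_on_subset[OF F_cont]) auto
  fix x assume x: "p < x" "x < q"
  then have x': "0 < x" "x < a" using assms by auto
  have "((\<lambda>p. F p / p^2) has_real_derivative (\<theta> x * x - 2 * F x) / x^3) (at x)"
    using x' by (auto intro!: derivative_eq_intros F_deriv simp: field_simps power2_eq_square power3_eq_cube)
  moreover have "(\<theta> x * x - 2 * F x) / x^3 \<le> 0" using F_lower[of x] x' by (simp add: divide_nonpos_pos mult.commute)
  ultimately show "\<exists>y. ((\<lambda>p. F p / p^2) has_real_derivative y) (at x) \<and> y \<le> 0" by blast
qed

lemma mean_cont: "continuous_on {0<..<a} (\<lambda>q. F q / q)"
  by (intro continuous_intros continuous_on_subset[OF F_cont]) auto

lemma mean_bounds: "0 < q \<Longrightarrow> q \<le> a \<Longrightarrow> 0 < F q / q" "0 < q \<Longrightarrow> q \<le> p \<Longrightarrow> p \<le> a \<Longrightarrow> F q / q \<le> \<theta> p"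
proof -
  show "0 < F q / q" if "0 < q" "q \<le> a" using F_pos that by simp
  show "F q / q \<le> \<theta> p" if "0 < q" "q \<le> p" "p \<le> a"
  proof -
    have "F q / q \<le> \<theta> q" using F_upper[of q] that by (simp add: field_simps)
    also have "\<dots> \<le> \<theta> p" using mono that by simp
    finally show ?thesis .
  qed
qed

lemma mean_sq_int: assumes "p \<le> a" shows "(\<lambda>q. (F q / q)^2) integrable_on {0..p}"
proof (rule dominated_absolutely_integrable_interval(2)[where g = "\<lambda>_. (\<theta> p)^2"])
  show "continuous_on {0<..<p} (\<lambda>q. (F q / q)^2)"
    using assms by (intro continuous_on_power continuous_on_subset[OF mean_cont]) auto
  show "\<bar>(F q / q)^2\<bar> \<le> (\<theta> p)^2" if "0 < q" "q < p" for q
    using mean_bounds[of q] mean_bounds(2)[of q p] that assms by (auto intro!: power_mono)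
qed auto

lemma A_cont: "continuous_on {0..a} A"
  unfolding A_def by (rule indefinite_integral_continuous_1[OF mean_sq_int]) simp

lemma A_deriv: "0 < p \<Longrightarrow> p < a \<Longrightarrow> (A has_real_derivative (F p / p)^2) (at p)"
  unfolding A_def
  by (intro integral_deriv mean_sq_int continuous_intros) (auto intro: DERIV_isCont F_deriv)

lemma A_upper: assumes "0 < p" "p \<le> a" shows "A p \<le> p * (F p / p)^2"
proof -
  have "A p \<le> integral {0..p} (\<lambda>_. (F p / p)^2)"
    unfolding A_def
  proof (intro integral_le mean_sq_int)
    fix q assume q: "q \<in> {0..p}"
    show "(F q / q)^2 \<le> (F p / p)^2"
      using q assms mean_mono[of q p] mean_bounds(1)[of q] by (cases "q = 0") (auto intro!: power_mono)
  qed (use assms in auto)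
  then show ?thesis using assms by simp
qed

lemma ln_\<theta>_abs: assumes "p \<le> a" shows "(\<lambda>q. ln (\<theta> q)) absolutely_integrable_on {0<..<p}" "(\<lambda>q. ln (\<theta> q)) integrable_on {0..p}"
  and "0 < q \<Longrightarrow> q < p \<Longrightarrow> ln (\<theta> p) + (ln q - ln p) \<le> ln (\<theta> q)"
proof -
  have lo: "ln (\<theta> p) + (ln q - ln p) \<le> ln (\<theta> q)" if "0 < q" "q < p" for q
  proof -
    have "q * \<theta> p / p \<le> \<theta> q" using star[of q p] that assms by (simp add: field_simps)
    then have "ln (q * \<theta> p / p) \<le> ln (\<theta> q)" using that assms pos[of p] by (subst ln_le_cancel_iff) (auto intro!: pos)
    then show ?thesis using that assms pos[of p] by (simp add: ln_mult ln_div)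
  qed
  show "0 < q \<Longrightarrow> q < p \<Longrightarrow> ln (\<theta> p) + (ln q - ln p) \<le> ln (\<theta> q)" by (rule lo)
  have up: "ln (\<theta> q) \<le> ln (\<theta> p)" if "0 < q" "q < p" for q
    using mono[of q p] that assms pos[of q] by (subst ln_le_cancel_iff) (auto intro!: pos)
  have c: "continuous_on {0<..<p} (\<lambda>q. ln (\<theta> q))"
    using assms pos by (intro continuous_on_ln continuous_on_subset[OF \<theta>_cont]) force+
  have "\<bar>ln (\<theta> q)\<bar> \<le> \<bar>ln (\<theta> p)\<bar> + (ln p - ln q)" if "0 < q" "q < p" for q
    using lo[OF that] up[OF that] by linarith
  moreover have "(\<lambda>q. \<bar>ln (\<theta> p)\<bar> + (ln p - ln q)) integrable_on {0..p}"
    using has_integral_ln[of p] by (cases "0 \<le> p") (auto intro!: integrable_add integrable_diff integrable_const_ivl)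
  ultimately show "(\<lambda>q. ln (\<theta> q)) absolutely_integrable_on {0<..<p}" "(\<lambda>q. ln (\<theta> q)) integrable_on {0..p}"
    using dominated_absolutely_integrable_interval[OF c] by blast+
qed

lemma L_cont: "continuous_on {0..a} L"
  unfolding L_def by (rule indefinite_integral_continuous_1[OF ln_\<theta>_abs(2)]) simp

lemma L_deriv: assumes "0 < p" "p < a" shows "(L has_real_derivative ln (\<theta> p)) (at p)"
  unfolding L_def using assms pos[of p] \<theta>_isCont[of p]
  by (intro integral_deriv ln_\<theta>_abs isCont_ln') auto

lemma L_upper: "L a \<le> a * ln (\<theta> a)"
proof -
  have "integral {0<..<a} (\<lambda>q. ln (\<theta> q)) \<le> integral {0<..<a} (\<lambda>_. ln (\<theta> a))"
  proof (intro integral_le)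
    show "ln (\<theta> q) \<le> ln (\<theta> a)" if "q \<in> {0<..<a}" for q
      using mono[of q a] that pos[of q] by (subst ln_le_cancel_iff) (auto intro!: pos)
  qed (auto simp: integrable_on_open_interval_real ln_\<theta>_abs)
  then show ?thesis
    using a unfolding L_def integral_open_interval_real[symmetric] by (simp add: mult.commute)
qed

lemma L_lower: "a * ln (\<theta> a) - a \<le> L a"
proof -
  have h: "((\<lambda>q. ln (\<theta> a) + (ln q - ln a)) has_integral (a * ln (\<theta> a) - a)) {0..a}"
  proof -
    have "((\<lambda>q. ln (\<theta> a) + (ln q - ln a)) has_integral (ln (\<theta> a) * (a - 0) + ((a * ln a - a) - ln a * (a - 0)))) {0..a}"
      using a has_integral_ln[of a] has_integral_const_real[of "ln (\<theta> a)" 0 a] has_integral_const_real[of "ln a" 0 a]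
      by (intro has_integral_add has_integral_diff) (auto simp: mult.commute)
    then show ?thesis by (simp add: algebra_simps)
  qed
  have "integral {0<..<a} (\<lambda>q. ln (\<theta> a) + (ln q - ln a)) \<le> integral {0<..<a} (\<lambda>q. ln (\<theta> q))"
    using ln_\<theta>_abs[of a] h by (intro integral_le) (auto simp: integrable_on_open_interval_real integral_unique)
  then show ?thesis unfolding L_def integral_open_interval_real[symmetric] integral_unique[OF h] .
qed

text \<open>Among the profiles with given values of \<open>F p\<close> and \<open>\<theta> p = T\<close>, the smallest variance belongs to
  \<open>q \<mapsto> T min (q / c) 1\<close>, where \<open>c = s p\<close> is chosen such that \<open>F p\<close> has the prescribed value. Indeed
  \<open>F\<close> lies above the integral of this profile: to the right of \<open>c\<close> because \<open>\<theta> \<le> T\<close>, and to the left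
  of \<open>c\<close> because \<open>F q / q\<^sup>2\<close> decreases.\<close>
lemma A_lower:
  assumes p: "0 < p" "p < a"
  defines "s \<equiv> 2 * (1 - F p / (p * \<theta> p))"
  shows "p * (\<theta> p)^2 * (1 - 2 * s / 3 + s * ln s - s^2/4) \<le> A p"
proof -
  define T where "T = \<theta> p"
  define c where "c = s * p"
  have T: "0 < T" using pos p by (simp add: T_def)
  have s01: "0 \<le> s" "s \<le> 1"
    using F_upper[of p] F_lower[of p] p T by (auto simp: s_def T_def[symmetric] field_simps)
  have c: "0 \<le> c" "c \<le> p" using s01 p by (auto simp: c_def mult_left_le_one_le)
  have Fp: "F p = T * (p - c/2)" using p T by (simp add: c_def s_def T_def[symmetric] field_simps)
  have tail: "T * (1 - c / (2 * q)) \<le> F q / q" if q: "c \<le> q" "q \<le> p" "0 < q" for q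
  proof -
    have "T * (q - c/2) \<le> F q" using F_incr[of q p] q p Fp by (simp add: T_def algebra_simps)
    then have "T * (q - c/2) / q \<le> F q / q" using q by (intro divide_right_mono) auto
    moreover have "T * (q - c/2) / q = T * (1 - c / (2 * q))" using q by (simp add: field_simps)
    ultimately show ?thesis by simp
  qed
  have head: "T * q / (2 * c) \<le> F q / q" if q: "0 < q" "q \<le> c" for q
  proof -
    have "T / (2 * c) \<le> F c / c^2" using tail[of c] q c by (simp add: field_simps power2_eq_square)
    also have "\<dots> \<le> F q / q^2" using F_over_square_antimono[of q c] q c p by simp
    finally show ?thesis using q by (simp add: field_simps power2_eq_square)
  qed
  have I1: "((\<lambda>q. (T * q / (2 * c))^2) has_integral (T^2 * c / 12)) {0..c}"
  proof -
    have "((\<lambda>q. (T * q / (2 * c))^2) has_integral (T^2 * c^3 / (12 * c^2) - T^2 * 0^3 / (12 * c^2))) {0..c}"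
    proof (rule fundamental_theorem_of_calculus[OF c(1)])
      fix x
      show "((\<lambda>q. T^2 * q^3 / (12 * c^2)) has_vector_derivative (T * x / (2 * c))^2) (at x within {0..c})"
        unfolding has_real_derivative_iff_has_vector_derivative[symmetric]
        by (cases "c = 0") (auto intro!: derivative_eq_intros simp: field_simps power2_eq_square power3_eq_cube)
    qed
    then show ?thesis by (cases "c = 0") (simp_all add: field_simps power2_eq_square power3_eq_cube)
  qed
  have I2: "((\<lambda>q. (T * (1 - c / (2 * q)))^2) has_integral
      (T^2 * (p - c * ln p - c^2/(4 * p)) - T^2 * (c - c * ln c - c^2/(4 * c)))) {c..p}"
  proof (cases "c = 0")
    case True
    then show ?thesis using has_integral_const_real[of "T^2" 0 p] p by (simp add: mult.commute)
  next
    case False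
    then have c0: "0 < c" using c by simp
    show ?thesis
    proof (rule fundamental_theorem_of_calculus[OF c(2)])
      fix x assume "x \<in> {c..p}"
      then have x: "0 < x" using c0 by auto
      show "((\<lambda>q. T^2 * (q - c * ln q - c^2/(4 * q))) has_vector_derivative (T * (1 - c / (2 * x)))^2) (at x within {c..p})"
        unfolding has_real_derivative_iff_has_vector_derivative[symmetric]
        using x by (auto intro!: derivative_eq_intros simp: field_simps power2_eq_square)
    qed
  qed
  \<comment> \<open>for \<open>c = 0\<close> the point \<open>q = 0\<close>, where \<open>F q / q\<close> is the junk value 0, has to be left out\<close>
  have I2': "((\<lambda>q. if q = 0 then 0 else (T * (1 - c / (2 * q)))^2) has_integral
      (T^2 * (p - c * ln p - c^2/(4 * p)) - T^2 * (c - c * ln c - c^2/(4 * c)))) {c..p}"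
    by (rule has_integral_spike_finite[OF _ _ I2, of "{0}"]) auto
  have "A p = integral {0..c} (\<lambda>q. (F q / q)^2) + integral {c..p} (\<lambda>q. (F q / q)^2)"
    unfolding A_def using c p by (intro Henstock_Kurzweil_Integration.integral_combine[symmetric] mean_sq_int) auto
  moreover have "T^2 * c / 12 \<le> integral {0..c} (\<lambda>q. (F q / q)^2)"
  proof (rule has_integral_le[OF I1 integrable_integral[OF mean_sq_int]])
    fix q assume q: "q \<in> {0..c}"
    show "(T * q / (2 * c))^2 \<le> (F q / q)^2"
      using q head[of q] T by (cases "q = 0") (auto intro!: power_mono)
  qed (use c p in auto)
  moreover have "T^2 * (p - c * ln p - c^2/(4 * p)) - T^2 * (c - c * ln c - c^2/(4 * c))
      \<le> integral {c..p} (\<lambda>q. (F q / q)^2)"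
  proof (rule has_integral_le[OF I2' integrable_integral[OF integrable_on_subinterval[OF mean_sq_int[of p]]]])
    fix q assume q: "q \<in> {c..p}"
    show "(if q = 0 then 0 else (T * (1 - c / (2 * q)))^2) \<le> (F q / q)^2"
    proof (cases "q = 0")
      case False
      then have q0: "0 < q" using q c by auto
      then have "0 \<le> T * (1 - c / (2 * q))" using q c T by (simp add: field_simps)
      then show ?thesis using q q0 tail[of q] by (simp add: power_mono)
    qed simp
  qed (use c p in auto)
  ultimately have "T^2 * (c / 12 + (p - c * ln p - c^2/(4 * p)) - (c - c * ln c - c^2/(4 * c))) \<le> A p"
    by (simp add: algebra_simps)
  moreover have "c / 12 + (p - c * ln p - c^2/(4 * p)) - (c - c * ln c - c^2/(4 * c))
     = p * (1 - 2 * s / 3 + s * ln s - s^2/4)"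
  proof (cases "s = 0")
    case True then show ?thesis by (simp add: c_def)
  next
    case False
    then have "ln c = ln s + ln p" using p s01 by (simp add: c_def ln_mult)
    then show ?thesis using False p by (simp add: c_def field_simps power2_eq_square)
  qed
  ultimately have "T^2 * (p * (1 - 2 * s / 3 + s * ln s - s^2/4)) \<le> A p" by (simp only:)
  then show ?thesis unfolding T_def by (simp only: mult_ac)
qed

lemma A_pos: assumes "0 < p" "p \<le> a" shows "0 < A p"
proof -
  have "((\<lambda>q. (\<theta> p / (2 * p))^2 * q^2) has_integral ((\<theta> p / (2 * p))^2 * p^3/3 - (\<theta> p / (2 * p))^2 * 0^3/3)) {0..p}"
    using assms by (intro fundamental_theorem_of_calculus)
      (auto intro!: derivative_eq_intros simp: has_real_derivative_iff_has_vector_derivative[symmetric])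
  then have "(\<theta> p / (2 * p))^2 * p^3/3 - (\<theta> p / (2 * p))^2 * 0^3/3 \<le> A p"
    unfolding A_def
  proof (rule has_integral_le[OF _ integrable_integral[OF mean_sq_int]])
    fix q assume q: "q \<in> {0..p}"
    show "(\<theta> p / (2 * p))^2 * q^2 \<le> (F q / q)^2"
    proof (cases "q = 0")
      case False
      then have "\<theta> p / (2 * p) * q \<le> \<theta> q / 2" using star[of q p] q assms by (simp add: field_simps)
      also have "\<dots> \<le> F q / q" using F_lower[of q] q assms False by (simp add: field_simps)
      finally show ?thesis
        unfolding power_mult_distrib[symmetric] using q assms pos[of p] by (intro power_mono) auto
    qed simp
  qed (use assms in auto)
  moreover have "0 < (\<theta> p / (2 * p))^2 * p^3/3" using assms pos[of p] by simp
  ultimately show ?thesis by simp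
qed

text \<open>The scale-invariant form of \<open>lower_variance_scalar\<close> for the law conditioned at tail mass \<open>p\<close>,
  whose density at the left end is \<open>1 / \<theta> p\<close>.\<close>
lemma residual_inequality:
  assumes p: "0 < p" "p < a"
  shows "ln (A p / p) + (F p / p)^2 / (A p / p) \<le> 1 + 2 * ln (\<theta> p)"
proof -
  define T where "T = \<theta> p"
  define s where "s = 2 * (1 - F p / (p * T))"
  define v where "v = A p / (p * T^2)"
  have T: "0 < T" using pos p by (simp add: T_def)
  have r: "1 - s/2 = F p / (p * T)" by (simp add: s_def diff_divide_distrib)
  have "ln v + (1 - s/2)^2 / v \<le> 1"
  proof (rule lower_variance_scalar)
    show "0 \<le> s" "s \<le> 1"
      using F_upper[of p] F_lower[of p] p T by (auto simp: s_def T_def[symmetric] field_simps)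
    show "0 < v" using A_pos[of p] p T by (simp add: v_def)
    show "v \<le> (1 - s/2)^2"
      using A_upper[of p] p T unfolding r v_def by (simp add: field_simps power2_eq_square)
    show "1 - 2 * s / 3 + s * ln s - s^2/4 \<le> v"
      using A_lower[OF p] p T unfolding v_def T_def[symmetric] s_def[symmetric] by (simp add: field_simps)
  qed
  moreover have "ln v = ln (A p / p) - 2 * ln T"
    using A_pos[of p] p T by (simp add: v_def ln_div ln_mult ln_realpow)
  moreover have "(1 - s/2)^2 / v = (F p / p)^2 / (A p / p)"
    using A_pos[of p] p T by (simp add: r v_def field_simps power2_eq_square)
  ultimately show ?thesis by (simp add: T_def)
qed

text \<open>The function \<open>W p\<close> is \<open>p\<close> times the deficit in the claim for the law conditioned at tail mass \<open>p\<close>.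
  Its derivative is half the deficit in \<open>residual_inequality\<close>, so \<open>W\<close> is nondecreasing, and it is
  bounded below by a function that vanishes as \<open>p\<close> tends to 0.\<close>
lemma variance_le: "A a \<le> a * exp (2 * L a / a)"
proof -
  define W where "W p = L p - p/2 * ln (A p / p)" for p
  have W_cont: "continuous_on {e..a} W" if "0 < e" for e
    unfolding W_def
  proof (intro continuous_intros)
    show "\<forall>x\<in>{e..a}. A x / x \<noteq> 0"
    proof
      fix x assume "x \<in> {e..a}"
      then have "0 < A x" "0 < x" using that by (auto intro!: A_pos)
      then show "A x / x \<noteq> 0" by simp
    qed
    show "continuous_on {e..a} L" "continuous_on {e..a} A"
      using that by (auto intro: continuous_on_subset[OF L_cont] continuous_on_subset[OF A_cont])
  qed (use that in auto)
  have W_mono: "W e \<le> W a" if "0 < e" "e < a" for e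
  proof (rule DERIV_nonneg_imp_increasing_open[of e a W])
    fix p assume "e < p" "p < a"
    then have p: "0 < p" "p < a" using that by auto
    define D where "D = ln (\<theta> p) - (1/2 * ln (A p / p) + p/2 * (((F p / p)^2 * p - A p) / p^2 / (A p / p)))"
    have "(W has_real_derivative D) (at p)"
    proof -
      have "((\<lambda>p. A p / p) has_real_derivative ((F p / p)^2 * p - A p) / p^2) (at p)"
        using p by (auto intro!: derivative_eq_intros A_deriv simp: power2_eq_square)
      from DERIV_chain2[OF DERIV_ln_divide this]
      have "((\<lambda>p. ln (A p / p)) has_real_derivative ((F p / p)^2 * p - A p) / p^2 / (A p / p)) (at p)"
        using p A_pos[of p] by (simp add: mult.commute)
      moreover have "((\<lambda>p. p / 2) has_real_derivative 1 / 2) (at p)"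
        by (auto intro!: derivative_eq_intros)
      ultimately have "((\<lambda>p. p / 2 * ln (A p / p)) has_real_derivative
          (1/2 * ln (A p / p) + ((F p / p)^2 * p - A p) / p^2 / (A p / p) * (p/2))) (at p)"
        by (rule DERIV_mult[rotated])
      then show ?thesis
        unfolding W_def D_def using L_deriv p by (subst mult.commute[of "p/2"]) (intro DERIV_diff)
    qed
    moreover have "D = (1 + 2 * ln (\<theta> p) - (ln (A p / p) + (F p / p)^2 / (A p / p))) / 2"
    proof -
      have "p/2 * ((Y * p - X) / p^2 / (X / p)) = (Y / (X / p) - 1) / 2" if "0 < X" for X Y
        using p that by (simp add: field_simps power2_eq_square)
      from this[OF A_pos, of p "(F p / p)^2"] p
      have eq: "p/2 * (((F p / p)^2 * p - A p) / p^2 / (A p / p)) = ((F p / p)^2 / (A p / p) - 1) / 2" by simp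
      have "x - (1/2 * y + (z - 1) / 2) = (1 + 2 * x - (y + z)) / 2" for x y z :: real
        by (simp add: field_simps)
      then show ?thesis unfolding D_def eq .
    qed
    ultimately show "\<exists>y. (W has_real_derivative y) (at p) \<and> 0 \<le> y"
      using residual_inequality[OF p] by auto
  qed (use that W_cont in auto)
  \<comment> \<open>the variance at level \<open>e\<close> is at most \<open>(\<theta> a)\<^sup>2\<close>\<close>
  have low: "L e - e/2 * (2 * ln (\<theta> a)) \<le> W a" if "0 < e" "e < a" for e
  proof -
    have "A e / e \<le> (F e / e)^2" using A_upper[of e] that by (simp add: field_simps)
    also have "\<dots> \<le> (\<theta> a)^2" using mean_bounds(2)[of e a] mean_bounds(1)[of e] that by (intro power_mono) auto
    finally have "ln (A e / e) \<le> ln ((\<theta> a)^2)" using A_pos[of e] that by (intro ln_mono) auto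
    also have "\<dots> = 2 * ln (\<theta> a)" using pos[of a] a by (simp add: ln_realpow)
    finally have "e/2 * ln (A e / e) \<le> e/2 * (2 * ln (\<theta> a))" using that by (intro mult_left_mono) auto
    then show ?thesis using W_mono[OF that] unfolding W_def by linarith
  qed
  have "((\<lambda>e. L e - e/2 * (2 * ln (\<theta> a))) \<longlongrightarrow> L 0 - 0/2 * (2 * ln (\<theta> a))) (at 0 within {0..a})"
    using L_cont a by (intro tendsto_intros) (auto simp: continuous_on_def)
  then have "((\<lambda>e. L e - e/2 * (2 * ln (\<theta> a))) \<longlongrightarrow> 0) (at_right 0)"
    using a by (simp add: at_within_Icc_at_right L_def)
  moreover have "\<forall>\<^sub>F e in at_right 0. L e - e/2 * (2 * ln (\<theta> a)) \<le> W a"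
    using low a by (auto simp: eventually_at_right_field)
  ultimately have "0 \<le> W a" using tendsto_upperbound trivial_limit_at_right_real by blast
  then have "ln (A a / a) \<le> 2 * L a / a" using a by (simp add: W_def field_simps)
  then have "A a / a \<le> exp (2 * L a / a)" using A_pos[of a] a by (metis divide_pos_pos exp_le_cancel_iff exp_ln order_refl)
  then show ?thesis using a by (simp add: field_simps)
qed

text \<open>Integrate \<open>d/dp (F\<^sup>2 / p) = 2 F \<theta> / p - (F / p)\<^sup>2\<close>. The left-hand integrand is the one
  that Fubini produces for the second moment about the left end of the support.\<close>
lemma second_moment:
  "((\<lambda>p. 2 * (F p / p) * \<theta> p) has_integral (A a + (F a)^2 / a)) {0..a}"
proof -
  have "((\<lambda>p. 2 * (F p / p) * \<theta> p - (F p / p)^2) has_integral ((F a)^2 / a - (F 0)^2 / 0)) {0..a}"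
  proof (rule fundamental_theorem_of_calculus_interior)
    show "continuous_on {0..a} (\<lambda>p. (F p)^2 / p)"
      unfolding continuous_on_eq_continuous_within
    proof
      fix x assume x: "x \<in> {0..a}"
      show "continuous (at x within {0..a}) (\<lambda>p. (F p)^2 / p)"
      proof (cases "x = 0")
        case True
        have "((\<lambda>p. (F p)^2 / p) \<longlongrightarrow> 0) (at 0 within {0..a})"
        proof (rule Lim_null_comparison)
          show "\<forall>\<^sub>F p in at 0 within {0..a}. norm ((F p)^2 / p) \<le> (\<theta> a)^2 * p"
            unfolding eventually_at_filter
          proof (intro always_eventually allI impI)
            fix p assume "p \<noteq> 0" "p \<in> {0..a}"
            then have p: "0 < p" "p \<le> a" by auto
            have "(F p / p)^2 \<le> (\<theta> a)^2"
              using mean_bounds(2)[of p a] mean_bounds(1)[of p] p by (intro power_mono) auto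
            then have "(F p / p)^2 * p \<le> (\<theta> a)^2 * p" using p by (intro mult_right_mono) auto
            then show "norm ((F p)^2 / p) \<le> (\<theta> a)^2 * p" using p by (simp add: power2_eq_square)
          qed
          show "((\<lambda>p. (\<theta> a)^2 * p) \<longlongrightarrow> 0) (at 0 within {0..a})" by (auto intro!: tendsto_eq_intros)
        qed
        then show ?thesis by (simp add: continuous_within True)
      next
        case False
        then show ?thesis using F_cont x
          by (intro continuous_intros) (auto simp: continuous_on_eq_continuous_within)
      qed
    qed
    fix x assume "x \<in> {0<..<a}"
    then have x: "0 < x" "x < a" by auto
    show "((\<lambda>p. (F p)^2 / p) has_vector_derivative 2 * (F x / x) * \<theta> x - (F x / x)^2) (at x)"
      unfolding has_real_derivative_iff_has_vector_derivative[symmetric]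
      using x by (auto intro!: derivative_eq_intros F_deriv simp: field_simps power2_eq_square)
  qed (use a in auto)
  moreover have "((\<lambda>p. (F p / p)^2) has_integral A a) {0..a}"
    unfolding A_def by (intro integrable_integral mean_sq_int) simp
  ultimately have "((\<lambda>p. 2 * (F p / p) * \<theta> p - (F p / p)^2 + (F p / p)^2) has_integral
      ((F a)^2 / a - (F 0)^2 / 0 + A a)) {0..a}" by (rule has_integral_add)
  then show ?thesis by (simp add: add.commute)
qed

text \<open>With \<open>C = \<theta> a\<close> and \<open>\<psi> t = 2 + ln t - 2 t\<close> the claim says that \<open>\<psi> (\<theta> / C)\<close> has a nonnegative
  integral. The function \<open>\<psi>\<close> increases up to \<open>1/2\<close> and decreases afterwards, it vanishes at 1, and
  its integral over the unit interval is 0. Hence \<open>\<psi> (min (p / c) 1)\<close> has integral 0 for every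
  \<open>c \<in> (0, a]\<close>, and it suffices to find \<open>c\<close> such that \<open>\<theta> p / C\<close> always lies between \<open>1/2\<close> and
  \<open>min (p / c) 1\<close>. As \<open>p / \<theta> p\<close> is nondecreasing, the supremum \<open>c\<close> of \<open>C p / \<theta> p\<close> over the points
  with \<open>\<theta> p < C / 2\<close> is such a choice. If there are no such points, \<open>\<psi> (\<theta> / C)\<close> is nonnegative.\<close>
lemma F_le: "2 * F a / a \<le> \<theta> a * (2 + L a / a - ln (\<theta> a))"
proof -
  define C where "C = \<theta> a"
  have C: "0 < C" using pos a by (simp add: C_def)
  define \<psi> :: "real \<Rightarrow> real" where "\<psi> t = 2 + ln t - 2 * t" for t
  have \<psi>_anti: "\<psi> y \<le> \<psi> x" if "1/2 \<le> x" "x \<le> y" for x y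
  proof -
    have "ln (y / x) \<le> y / x - 1" using that by (intro ln_le_minus_one) auto
    also have "\<dots> = (y - x) / x" using that by (simp add: field_simps)
    also have "\<dots> \<le> (y - x) / (1/2)" using that by (intro divide_left_mono) auto
    finally show ?thesis using that by (simp add: \<psi>_def ln_div)
  qed
  have \<psi>_mono: "\<psi> x \<le> \<psi> y" if "0 < x" "x \<le> y" "y \<le> 1/2" for x y
  proof -
    have "ln (x / y) \<le> x / y - 1" using that by (intro ln_le_minus_one) auto
    also have "\<dots> = - ((y - x) / y)" using that by (simp add: field_simps)
    also have "\<dots> \<le> - ((y - x) / (1/2))" using that by (intro le_imp_neg_le divide_left_mono) auto
    finally show ?thesis using that by (simp add: \<psi>_def ln_div)
  qed
  define Z where "Z = {p. 0 < p \<and> p < a \<and> \<theta> p < C / 2}"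
  have le1: "p / \<theta> p * C \<le> a" if "0 < p" "p \<le> a" for p
    using star[of p a] pos[of p] that by (simp add: C_def field_simps)
  have "\<exists>g. (g has_integral 0) {0..a} \<and> (\<forall>p. 0 < p \<longrightarrow> p < a \<longrightarrow> g p \<le> \<psi> (\<theta> p / C))"
  proof (cases "Z = {}")
    case True
    have "0 \<le> \<psi> (\<theta> p / C)" if p: "0 < p" "p < a" for p
    proof -
      have "1/2 \<le> \<theta> p / C" using p C True by (auto simp: Z_def field_simps)
      moreover have "\<theta> p / C \<le> 1" using mono[of p a] p C by (simp add: C_def)
      ultimately show ?thesis using \<psi>_anti[of "\<theta> p / C" 1] by (simp add: \<psi>_def)
    qed
    then show ?thesis by (intro exI[of _ "\<lambda>_. 0"]) auto
  next
    case ne: False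
    define c where "c = Sup ((\<lambda>p. p / \<theta> p * C) ` Z)"
    have bdd: "bdd_above ((\<lambda>p. p / \<theta> p * C) ` Z)" using le1 by (auto simp: Z_def intro!: bdd_aboveI2[of _ _ a])
    have cZ: "p / \<theta> p * C \<le> c" if "p \<in> Z" for p
      unfolding c_def by (rule cSUP_upper[OF that bdd])
    obtain z where "z \<in> Z" using ne by auto
    then have "0 < z / \<theta> z * C" using pos[of z] C by (auto simp: Z_def)
    then have c0: "0 < c" using cZ[OF \<open>z \<in> Z\<close>] by linarith
    have ca: "c \<le> a" unfolding c_def using ne le1 by (intro cSUP_least) (auto simp: Z_def)
    have cN: "c \<le> p / \<theta> p * C" if p: "0 < p" "p < a" "p \<notin> Z" for p
      unfolding c_def
    proof (rule cSUP_least[OF ne])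
      fix z assume z: "z \<in> Z"
      have "z \<le> p"
      proof (rule ccontr)
        assume "\<not> z \<le> p"
        then show False using mono[of p z] z p by (auto simp: Z_def)
      qed
      then have "z * \<theta> p \<le> p * \<theta> z" "0 < \<theta> z" "0 < \<theta> p"
        using z p by (auto simp: Z_def intro!: star pos)
      then have "z / \<theta> z \<le> p / \<theta> p" by (simp add: field_simps)
      then show "z / \<theta> z * C \<le> p / \<theta> p * C" using C by (intro mult_right_mono) auto
    qed
    define g where "g p = (if p \<le> c then \<psi> (p / c) else 0)" for p
    have "g p \<le> \<psi> (\<theta> p / C)" if p: "0 < p" "p < a" for p
    proof (cases "p \<in> Z")
      case True
      then have "p / c \<le> \<theta> p / C" using cZ[OF True] c0 C pos[of p] p by (simp add: field_simps)
      moreover have "\<theta> p / C \<le> 1/2" using True C by (simp add: Z_def field_simps)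
      ultimately have half: "p / c \<le> 1/2" and le: "\<psi> (p / c) \<le> \<psi> (\<theta> p / C)"
        using \<psi>_mono[of "p/c" "\<theta> p / C"] p c0 by (linarith, auto)
      have "p * 2 \<le> c" using half c0 by (simp add: pos_divide_le_eq)
      with le p show ?thesis by (simp add: g_def)
    next
      case False
      then have half: "1/2 \<le> \<theta> p / C" using p C by (auto simp: Z_def field_simps)
      have le: "\<theta> p / C \<le> 1" using mono[of p a] p C by (simp add: C_def)
      have pc: "\<theta> p / C \<le> p / c" using cN[OF p False] c0 C pos[of p] p by (simp add: field_simps)
      show ?thesis
        using \<psi>_anti[OF half pc] \<psi>_anti[OF half le] by (simp add: \<psi>_def g_def)
    qed
    moreover have "(g has_integral 0) {0..a}"
    proof -
      have i1: "((\<lambda>p::real. 2::real) has_integral 2 * c) {0..c}" "((\<lambda>p::real. ln c) has_integral c * ln c) {0..c}"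
        using c0 has_integral_const_real[of "2::real" 0 c] has_integral_const_real[of "ln c" 0 c]
        by (simp_all add: mult.commute)
      have i2: "((\<lambda>p. 2 / c * p) has_integral (2 / c * ((c^2 - 0^2)/2))) {0..c}"
        using c0 by (intro has_integral_mult_right ident_has_integral) auto
      have "((\<lambda>p. 2 + (ln p - ln c) - 2 / c * p) has_integral
          (2 * c + ((c * ln c - c) - c * ln c) - 2 / c * ((c^2 - 0^2)/2))) {0..c}"
        using c0 by (intro has_integral_add has_integral_diff i1 i2 has_integral_ln) auto
      moreover have "2 * c + ((c * ln c - c) - c * ln c) - 2 / c * ((c^2 - 0^2)/2) = 0"
        using c0 by (simp add: power2_eq_square)
      ultimately have "((\<lambda>p. 2 + (ln p - ln c) - 2 / c * p) has_integral 0) {0..c}" by (simp only:)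
      then have "(g has_integral 0) {0..c}"
        by (rule has_integral_spike_finite[of "{0}", rotated 2]) (use c0 in \<open>auto simp: g_def \<psi>_def ln_div\<close>)
      moreover have "(g has_integral 0) {c..a}"
        by (rule has_integral_spike_finite[of "{c}" _ _ "\<lambda>_. 0"]) (auto simp: g_def)
      ultimately show ?thesis using has_integral_combine[of 0 c a g 0 0] c0 ca by auto
    qed
    ultimately show ?thesis by blast
  qed
  then obtain g where g: "(g has_integral 0) {0..a}" "\<And>p. 0 < p \<Longrightarrow> p < a \<Longrightarrow> g p \<le> \<psi> (\<theta> p / C)" by blast
  have "((\<lambda>p. 2 + (ln (\<theta> p) - ln C) - 2 / C * \<theta> p) has_integral (2 * a + (L a - ln C * a) - 2 / C * F a)) {0..a}"
    unfolding L_def F_def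
  proof (intro has_integral_add has_integral_diff has_integral_mult_right integrable_integral ln_\<theta>_abs \<theta>_int)
    show "((\<lambda>p::real. 2::real) has_integral 2 * a) {0..a}" "((\<lambda>p::real. ln C) has_integral ln C * a) {0..a}"
      using a has_integral_const_real[of "2::real" 0 a] has_integral_const_real[of "ln C" 0 a]
      by (simp_all add: mult.commute)
  qed auto
  then have "((\<lambda>p. 2 + (ln (\<theta> p) - ln C) - 2 / C * \<theta> p) has_integral (2 * a + (L a - ln C * a) - 2 / C * F a)) {0<..<a}"
    using has_integral_Icc_iff_Ioo by blast
  then have "((\<lambda>p. \<psi> (\<theta> p / C)) has_integral (2 * a + (L a - ln C * a) - 2 / C * F a)) {0<..<a}"
  proof (rule has_integral_eq[rotated])
    fix p assume "p \<in> {0<..<a}"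
    then have "0 < \<theta> p" using pos[of p] by simp
    then show "2 + (ln (\<theta> p) - ln C) - 2 / C * \<theta> p = \<psi> (\<theta> p / C)" using C by (simp add: \<psi>_def ln_div)
  qed
  moreover have "(g has_integral 0) {0<..<a}" using g(1) has_integral_Icc_iff_Ioo by blast
  ultimately have "0 \<le> 2 * a + (L a - ln C * a) - 2 / C * F a"
    using g(2) by (intro has_integral_le[of g 0 "{0<..<a}"]) auto
  then have "2 * F a \<le> C * (2 * a + L a - ln C * a)" using C by (simp add: field_simps)
  then show ?thesis using a unfolding C_def[symmetric] by (simp add: field_simps)
qed

end

section \<open>Decreasing log-concave functions on a half-line\<close>

text \<open>Tonelli's theorem for \<open>x - m\<close> as the length of the interval from \<open>m\<close> to \<open>x\<close>; the next lemma
  uses \<open>(x - m)\<^sup>2\<close> as the integral of \<open>2 (x - s)\<close> over the same interval.\<close>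
lemma nn_first_moment:
  fixes g :: "real \<Rightarrow> ennreal" and m :: real
  assumes [measurable]: "g \<in> borel_measurable borel"
  shows "(\<integral>\<^sup>+x. ennreal (x - m) * g x * indicator {m<..} x \<partial>lborel)
     = (\<integral>\<^sup>+s. (\<integral>\<^sup>+x. g x * indicator {s<..} x \<partial>lborel) * indicator {m<..} s \<partial>lborel)"
proof -
  have "(\<integral>\<^sup>+s. (\<integral>\<^sup>+x. g x * indicator {s<..} x \<partial>lborel) * indicator {m<..} s \<partial>lborel)
     = (\<integral>\<^sup>+s. (\<integral>\<^sup>+x. g x * (if m < s \<and> s < x then 1 else 0) \<partial>lborel) \<partial>lborel)"
    by (intro nn_integral_cong) (auto simp: indicator_def nn_integral_multc[symmetric] intro!: nn_integral_cong)
  also have "\<dots> = (\<integral>\<^sup>+x. (\<integral>\<^sup>+s. g x * (if m < s \<and> s < x then 1 else 0) \<partial>lborel) \<partial>lborel)"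
    by (rule lborel_pair.Fubini'[symmetric]) measurable
  also have "\<dots> = (\<integral>\<^sup>+x. ennreal (x - m) * g x * indicator {m<..} x \<partial>lborel)"
  proof (rule nn_integral_cong)
    fix x :: real
    have "(\<integral>\<^sup>+s. g x * (if m < s \<and> s < x then 1 else 0) \<partial>lborel)
        = (\<integral>\<^sup>+s. g x * indicator {m<..<x} s \<partial>lborel)"
      by (intro nn_integral_cong) (auto simp: indicator_def)
    also have "\<dots> = g x * emeasure lborel {m<..<x}" by (simp add: nn_integral_cmult_indicator)
    also have "\<dots> = ennreal (x - m) * g x * indicator {m<..} x"
      by (cases "m < x") (auto simp: mult.commute)
    finally show "(\<integral>\<^sup>+s. g x * (if m < s \<and> s < x then 1 else 0) \<partial>lborel)
       = ennreal (x - m) * g x * indicator {m<..} x" .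
  qed
  finally show ?thesis by simp
qed

lemma nn_second_moment:
  fixes g :: "real \<Rightarrow> ennreal" and m :: real
  assumes [measurable]: "g \<in> borel_measurable borel"
  shows "(\<integral>\<^sup>+x. ennreal ((x - m)^2) * g x * indicator {m<..} x \<partial>lborel)
     = (\<integral>\<^sup>+s. 2 * (\<integral>\<^sup>+x. ennreal (x - s) * g x * indicator {s<..} x \<partial>lborel) * indicator {m<..} s \<partial>lborel)"
proof -
  have sq: "(\<integral>\<^sup>+s. (2 * ennreal (x - s)) * indicator {m<..<x} s \<partial>lborel) = ennreal ((x - m)^2)" if "m < x" for x
  proof -
    have "((\<lambda>s. 2 * (x - s)) has_integral ((- ((x - x)^2)) - (- ((x - m)^2)))) {m..x}"
      using that by (intro fundamental_theorem_of_calculus)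
        (auto intro!: derivative_eq_intros simp: has_real_derivative_iff_has_vector_derivative[symmetric])
    then have "((\<lambda>s. 2 * (x - s)) has_integral (x - m)^2) {m<..<x}"
      by (simp add: has_integral_Icc_iff_Ioo)
    from nn_integral_has_integral_lebesgue'[OF _ this]
    have "(\<integral>\<^sup>+s. ennreal (2 * (x - s)) * indicator {m<..<x} s \<partial>lborel) = ennreal ((x - m)^2)" by simp
    moreover have "ennreal (2 * (x - s)) = 2 * ennreal (x - s)" for s
      using ennreal_mult'[of 2 "x - s"] by simp
    ultimately show ?thesis by (simp only:)
  qed
  have "(\<integral>\<^sup>+s. 2 * (\<integral>\<^sup>+x. ennreal (x - s) * g x * indicator {s<..} x \<partial>lborel) * indicator {m<..} s \<partial>lborel)
     = (\<integral>\<^sup>+s. (\<integral>\<^sup>+x. (2 * ennreal (x - s)) * g x * (if m < s \<and> s < x then 1 else 0) \<partial>lborel) \<partial>lborel)"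
    by (intro nn_integral_cong)
      (auto simp: indicator_def nn_integral_multc[symmetric] nn_integral_cmult[symmetric] mult.assoc intro!: nn_integral_cong)
  also have "\<dots> = (\<integral>\<^sup>+x. (\<integral>\<^sup>+s. (2 * ennreal (x - s)) * g x * (if m < s \<and> s < x then 1 else 0) \<partial>lborel) \<partial>lborel)"
    by (rule lborel_pair.Fubini'[symmetric]) measurable
  also have "\<dots> = (\<integral>\<^sup>+x. ennreal ((x - m)^2) * g x * indicator {m<..} x \<partial>lborel)"
  proof (rule nn_integral_cong)
    fix x :: real
    have "(\<integral>\<^sup>+s. (2 * ennreal (x - s)) * g x * (if m < s \<and> s < x then 1 else 0) \<partial>lborel)
        = (\<integral>\<^sup>+s. g x * ((2 * ennreal (x - s)) * indicator {m<..<x} s) \<partial>lborel)"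
      by (intro nn_integral_cong) (auto simp: indicator_def mult.commute)
    also have "\<dots> = g x * (\<integral>\<^sup>+s. (2 * ennreal (x - s)) * indicator {m<..<x} s \<partial>lborel)"
      by (rule nn_integral_cmult) measurable
    also have "\<dots> = ennreal ((x - m)^2) * g x * indicator {m<..} x"
      using sq[of x] by (cases "m < x") (auto simp: mult.commute)
    finally show "(\<integral>\<^sup>+s. (2 * ennreal (x - s)) * g x * (if m < s \<and> s < x then 1 else 0) \<partial>lborel)
       = ennreal ((x - m)^2) * g x * indicator {m<..} x" .
  qed
  finally show ?thesis by simp
qed

text \<open>Assumption \<open>f_shift\<close> is the four-point form of log-concavity: \<open>x + t\<close> and \<open>y\<close> lie between \<open>x\<close>
  and \<open>y + t\<close>.\<close>
locale decreasing_log_concave =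
  fixes f :: "real \<Rightarrow> real" and m :: real
  assumes f_integrable: "integrable lborel f"
    and f_nonneg: "0 \<le> f x"
    and f_zero: "x \<le> m \<Longrightarrow> f x = 0"
    and f_anti: "m < x \<Longrightarrow> x \<le> y \<Longrightarrow> f y \<le> f x"
    and f_shift: "m < x \<Longrightarrow> x \<le> y \<Longrightarrow> 0 \<le> t \<Longrightarrow> f x * f (y + t) \<le> f (x + t) * f y"
    and open_support: "open {x. 0 < f x}"
    and f_cont: "continuous_on {x. 0 < f x} f"
    and mass_pos: "0 < (\<integral>x. f x \<partial>lborel)"
begin

definition "a = (\<integral>x. f x \<partial>lborel)"
definition "J = {x. 0 < f x}"
definition "S x = (\<integral>y. indicator {x<..} y * f y \<partial>lborel)"
text \<open>The height of \<open>f\<close> at the left end: \<open>f\<close> itself vanishes at \<open>m\<close>, so the value there is recovered as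
  a supremum.\<close>
definition "peak = Sup (f ` J)"

lemma [measurable]: "f \<in> borel_measurable borel"
  using borel_measurable_integrable[OF f_integrable] by simp

lemma a_pos: "0 < a" using mass_pos by (simp add: a_def)

lemma J_gt: "x \<in> J \<Longrightarrow> m < x"
  using f_zero[of x] by (force simp: J_def)

lemma J_down: "x \<in> J \<Longrightarrow> m < y \<Longrightarrow> y \<le> x \<Longrightarrow> y \<in> J"
  using f_anti[of y x] by (simp add: J_def)

lemma open_J: "open J" using open_support by (simp add: J_def)

lemma ind_int: "A \<in> sets borel \<Longrightarrow> integrable lborel (\<lambda>y. indicator A y * f y)"
  using integrable_mult_indicator[of A lborel f] f_integrable by simp

lemma J_ne: "J \<noteq> {}"
proof
  assume "J = {}"
  then have "\<not> 0 < f x" for x unfolding J_def by blast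
  then have "f x = 0" for x using f_nonneg[of x] by (simp add: order_antisym not_less)
  then show False using mass_pos by simp
qed

lemma S_nonneg: "0 \<le> S x"
  unfolding S_def using f_nonneg by (intro integral_nonneg_AE) auto

lemma S_m: "S m = a"
  unfolding S_def a_def using f_zero by (intro Bochner_Integration.integral_cong) (auto simp: indicator_def not_less)

lemma S_le_a: "S x \<le> a"
  unfolding S_def a_def using f_nonneg by (intro integral_mono ind_int f_integrable) (auto simp: indicator_def)

lemma S_diff: assumes "c \<le> x" shows "S x = S c - integral {c..x} f"
proof -
  have "S c = (\<integral>y. indicator {c<..x} y * f y + indicator {x<..} y * f y \<partial>lborel)"
    unfolding S_def using assms by (intro Bochner_Integration.integral_cong) (auto simp: indicator_def)
  also have "\<dots> = (\<integral>y. indicator {c<..x} y * f y \<partial>lborel) + S x"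
    unfolding S_def by (intro Bochner_Integration.integral_add ind_int) auto
  also have "(\<integral>y. indicator {c<..x} y * f y \<partial>lborel) = integral {c<..x} f"
    using set_borel_integral_eq_integral(2)[of "{c<..x}" f] ind_int[of "{c<..x}"]
    by (simp add: set_integrable_def set_lebesgue_integral_def)
  also have "\<dots> = integral {c..x} f"
    by (rule integral_spike_set; rule negligible_subset[of "{c}"]) auto
  finally show ?thesis by simp
qed

lemma f_int_on: "f integrable_on {c..d}"
  using set_borel_integral_eq_integral(1)[of "{c..d}" f] ind_int[of "{c..d}"]
  by (simp add: set_integrable_def)

lemma S_cont: "continuous_on UNIV S"
proof (rule continuous_at_imp_continuous_on, rule ballI)
  fix x :: real
  have "continuous_on {x - 1..x + 1} (\<lambda>y. S (x - 1) - integral {x - 1..y} f)"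
    by (intro continuous_intros indefinite_integral_continuous_1 f_int_on)
  then have "continuous_on {x - 1..x + 1} S"
    by (rule continuous_on_eq) (use S_diff[of "x - 1", symmetric] in auto)
  then show "isCont S x"
    by (rule continuous_on_interior) simp
qed

lemma S_deriv: assumes "x \<in> J" shows "(S has_real_derivative - f x) (at x)"
proof -
  have fc: "isCont f x" using f_cont open_J assms by (simp add: continuous_on_eq_continuous_at J_def)
  have "((\<lambda>u. integral {x - 1..u} f) has_vector_derivative f x) (at x within ({x - 1..x + 1} - {}))"
    by (rule integral_has_vector_derivative_continuous_at[OF f_int_on])
       (use fc in \<open>auto simp: continuous_at_imp_continuous_within\<close>)
  then have "((\<lambda>u. integral {x - 1..u} f) has_real_derivative f x) (at x)"
    by (simp add: has_real_derivative_iff_has_vector_derivative at_within_Icc_at)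
  then have "((\<lambda>u. S (x - 1) - integral {x - 1..u} f) has_real_derivative - f x) (at x)"
    by (auto intro!: derivative_eq_intros)
  then show ?thesis
    by (rule has_field_derivative_transform_within_open[of _ _ _ "{x - 1<..<x + 1}"])
      (use S_diff[of "x - 1", symmetric] in auto)
qed

lemma S_strict: assumes "x \<in> J" "y \<in> J" "x < y" shows "S y < S x"
proof (rule DERIV_neg_imp_decreasing[OF assms(3)])
  fix z assume "x \<le> z" "z \<le> y"
  then have "z \<in> J" using J_down[of y z] J_gt[of x] assms by auto
  then show "\<exists>d. (S has_real_derivative d) (at z) \<and> d < 0"
    using S_deriv by (intro exI[of _ "- f z"]) (auto simp: J_def)
qed

lemma S_bounds: assumes "x \<in> J" shows "0 < S x" "S x < a"
proof -
  obtain e where e: "0 < e" "ball x e \<subseteq> J" using open_J assms openE by blast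
  then have "x + e/2 \<in> J" by (auto simp: dist_real_def)
  then have "S (x + e/2) < S x" using S_strict assms e by simp
  then show "0 < S x" using S_nonneg[of "x + e/2"] by linarith
  have "(x + m) / 2 \<in> J" "(x + m) / 2 < x" using J_down[OF assms, of "(x + m) / 2"] J_gt[OF assms] by auto
  then show "S x < a" using S_strict[of "(x + m)/2" x] assms S_le_a[of "(x + m)/2"] by linarith
qed

lemma S_outside: "m < x \<Longrightarrow> x \<notin> J \<Longrightarrow> S x = 0"
proof -
  assume x: "m < x" "x \<notin> J"
  then have "f y = 0" if "x < y" for y using f_anti[of x y] f_nonneg[of y] f_nonneg[of x] that by (auto simp: J_def)
  then have "(\<lambda>y. indicator {x<..} y * f y) = (\<lambda>_. 0)" by (auto simp: indicator_def)
  then show "S x = 0" by (simp add: S_def)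
qed

lemma inj_S: "inj_on S J"
  by (rule linorder_inj_onI) (use S_strict in fastforce)+

lemma S_tendsto: "(S \<longlongrightarrow> 0) at_top"
proof -
  have "S = (\<lambda>x. a - (\<integral>y. indicator {..x} y *\<^sub>R f y \<partial>lborel))"
  proof
    fix x
    have "a = (\<integral>y. indicator {..x} y *\<^sub>R f y + indicator {x<..} y * f y \<partial>lborel)"
      unfolding a_def by (intro Bochner_Integration.integral_cong) (auto simp: indicator_def)
    also have "\<dots> = (\<integral>y. indicator {..x} y *\<^sub>R f y \<partial>lborel) + S x"
      unfolding S_def using ind_int[of "{..x}"] by (intro Bochner_Integration.integral_add ind_int) auto
    finally show "S x = a - (\<integral>y. indicator {..x} y *\<^sub>R f y \<partial>lborel)" by simp
  qed
  moreover have "((\<lambda>x. a - (\<integral>y. indicator {..x} y *\<^sub>R f y \<partial>lborel)) \<longlongrightarrow> a - a) at_top"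
    unfolding a_def by (intro tendsto_intros tendsto_integral_at_top f_integrable) simp
  ultimately show ?thesis by simp
qed

lemma S_image_from: assumes x0: "x0 = m \<or> x0 \<in> J" shows "S ` (J \<inter> {x0<..}) = {0<..<S x0}"
proof (intro equalityI subsetI)
  fix p assume "p \<in> S ` (J \<inter> {x0<..})"
  then obtain x where "x \<in> J" "x0 < x" "p = S x" by auto
  then show "p \<in> {0<..<S x0}" using S_bounds[of x] S_strict[of x0 x] x0 S_m by auto
next
  fix p assume "p \<in> {0<..<S x0}"
  then have p: "0 < p" "p < S x0" by auto
  have "\<forall>\<^sub>F x in at_top. S x < p" using S_tendsto p by (simp add: order_tendsto_iff)
  then obtain N where N: "\<And>x. N \<le> x \<Longrightarrow> S x < p" by (auto simp: eventually_at_top_linorder)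
  have "\<exists>x\<ge>x0. x \<le> max x0 N \<and> S x = p"
    using N[of "max x0 N"] p by (intro IVT2') (auto intro: continuous_on_subset[OF S_cont])
  then obtain x where x: "x0 \<le> x" "S x = p" by auto
  then have "x0 < x" using p by (cases "x = x0") auto
  moreover have "m \<le> x0" using x0 J_gt by fastforce
  ultimately have "x \<in> J" using S_outside[of x] x p by force
  then show "p \<in> S ` (J \<inter> {x0<..})" using x \<open>x0 < x\<close> by auto
qed

lemma J_m: "J \<inter> {m<..} = J" using J_gt by auto

lemma S_image: "S ` J = {0<..<a}"
  using S_image_from[of m] by (simp add: J_m S_m)

text \<open>The tail mass \<open>S x\<close> is the integral of \<open>f (x + t)\<close> over \<open>t > 0\<close>, so \<open>f_shift\<close> can be integrated.\<close>
lemma hazard: assumes "y \<in> J" "y \<le> x" shows "f y * S x \<le> S y * f x"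
proof -
  have sh: "S z = (\<integral>t. indicator {0<..} t * f (z + t) \<partial>lborel)" for z
  proof -
    have "S z = (\<integral>t. indicator {z<..} (z + 1 * t) * f (z + 1 * t) \<partial>lborel)"
      unfolding S_def by (subst lborel_integral_real_affine[of 1 _ z]) auto
    also have "\<dots> = (\<integral>t. indicator {0<..} t * f (z + t) \<partial>lborel)"
      by (intro Bochner_Integration.integral_cong) (auto simp: indicator_def)
    finally show ?thesis .
  qed
  have i: "integrable lborel (\<lambda>t. indicator {0<..} t * f (z + t))" for z
    using integrable_mult_indicator[OF _ lborel_integrable_real_affine[OF f_integrable, of 1 z], of "{0<..}"] by simp
  have "f y * S x = (\<integral>t. f y * (indicator {0<..} t * f (x + t)) \<partial>lborel)" by (simp add: sh)
  also have "\<dots> \<le> (\<integral>t. f x * (indicator {0<..} t * f (y + t)) \<partial>lborel)"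
    using f_shift[of y x] J_gt[of y] assms
    by (intro integral_mono integrable_mult_right i) (auto simp: indicator_def mult.commute)
  also have "\<dots> = S y * f x" by (simp add: sh mult.commute)
  finally show ?thesis .
qed

text \<open>This bounds \<open>f\<close> near \<open>m\<close> by its values elsewhere, which makes \<open>peak\<close> finite.\<close>
lemma f_bound: assumes "x \<in> J" "y \<in> J" shows "f y * S x \<le> a * f x"
proof (cases "y \<le> x")
  case True
  have "f y * S x \<le> S y * f x" using hazard assms True by blast
  also have "\<dots> \<le> a * f x" using S_le_a[of y] f_nonneg by (intro mult_right_mono) auto
  finally show ?thesis .
next
  case False
  then have "f y * S x \<le> f x * a" using f_anti[of x y] J_gt[of x] assms S_le_a S_nonneg f_nonneg by (intro mult_mono) auto
  then show ?thesis by (simp add: mult.commute)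
qed

lemma bdd_f: "bdd_above (f ` J)"
proof -
  obtain x where x: "x \<in> J" using J_ne by auto
  then have "f y \<le> a * f x / S x" if "y \<in> J" for y
    using f_bound[OF x that] S_bounds[OF x] by (simp add: field_simps)
  then show ?thesis by (auto intro!: bdd_aboveI2)
qed

lemma f_le_peak: "x \<in> J \<Longrightarrow> f x \<le> peak"
  unfolding peak_def by (rule cSUP_upper[OF _ bdd_f])

lemma peak_pos: "0 < peak"
  using J_ne f_le_peak by (force simp: J_def)

lemma peak_S: assumes x: "x \<in> J" shows "peak * S x \<le> a * f x"
proof -
  have "peak \<le> a * f x / S x" unfolding peak_def
    using f_bound[OF x] S_bounds[OF x] J_ne by (intro cSUP_least) (auto simp: field_simps)
  then show ?thesis using S_bounds[OF x] by (simp add: field_simps)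
qed

definition "Q = the_inv_into J S"
text \<open>At the left end of the support the tail mass is \<open>a\<close>, and \<open>f\<close> tends to \<open>peak\<close>.\<close>
definition "\<theta> p = (if p = 0 then 0 else if p < a then p / f (Q p) else a / peak)"

lemma Q: assumes "0 < p" "p < a" shows "Q p \<in> J" "S (Q p) = p"
  using the_inv_into_into[OF inj_S, of p J] f_the_inv_into_f[OF inj_S, of p] assms
  by (auto simp: Q_def S_image)

lemma \<theta>_S: "x \<in> J \<Longrightarrow> \<theta> (S x) = S x / f x"
  using S_bounds[of x] the_inv_into_f_f[OF inj_S, of x] by (simp add: \<theta>_def Q_def)

lemma \<theta>_a: "\<theta> a = a / peak" using a_pos by (simp add: \<theta>_def)

lemma Q_mono: assumes "0 < p" "p \<le> q" "q < a" shows "Q q \<le> Q p"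
proof (rule ccontr)
  assume "\<not> Q q \<le> Q p"
  then have "S (Q q) < S (Q p)" using assms Q by (intro S_strict) auto
  then show False using assms Q by simp
qed

text \<open>Monotonicity of \<open>\<theta>\<close> is \<open>hazard\<close>, and the second property is monotonicity of \<open>f\<close>; at the end
  point \<open>a\<close> both follow from the description of \<open>peak\<close> as a supremum.\<close>
sublocale mills_profile a \<theta>
proof
  show "0 < a" by (rule a_pos)
  show "\<theta> 0 = 0" by (simp add: \<theta>_def)
  fix p assume p: "0 < p" "p \<le> a"
  show "0 < \<theta> p" using p Q[of p] peak_pos a_pos by (auto simp: \<theta>_def J_def)
next
  fix p q assume pq: "0 \<le> p" "p \<le> q" "q \<le> a"
  show "\<theta> p \<le> \<theta> q"
  proof (cases "p = 0")
    case True
    then show ?thesis using pq Q[of q] peak_pos a_pos by (auto simp: \<theta>_def J_def)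
  next
    case False
    then have p0: "0 < p" "0 < q" using pq by auto
    show ?thesis
    proof (cases "q < a")
      case True
      have "f (Q q) * S (Q p) \<le> S (Q q) * f (Q p)" using Q_mono Q p0 pq True by (intro hazard) auto
      then show ?thesis using Q[of p] Q[of q] p0 pq True by (simp add: \<theta>_def J_def field_simps)
    next
      case False
      then have q: "q = a" using pq by simp
      show ?thesis
        using peak_S[of "Q p"] Q[of p] p0 pq peak_pos by (auto simp: \<theta>_def J_def q field_simps)
    qed
  qed
  show "p * \<theta> q \<le> q * \<theta> p"
  proof (cases "p = 0")
    case False
    then have p0: "0 < p" "0 < q" using pq by auto
    show ?thesis
    proof (cases "q < a")
      case True
      have "f (Q p) \<le> f (Q q)" using Q_mono Q p0 pq True J_gt by (intro f_anti) auto
      then show ?thesis using Q[of p] Q[of q] p0 pq True by (simp add: \<theta>_def J_def field_simps)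
    next
      case False
      then have q: "q = a" using pq by simp
      show ?thesis
        using f_le_peak[of "Q p"] Q[of p] p0 pq peak_pos by (auto simp: \<theta>_def J_def q field_simps)
    qed
  qed (simp add: \<theta>_def)
qed

text \<open>The change of variables \<open>p = S x\<close>, also for the part of the support beyond a point \<open>x0\<close>.\<close>
lemma substitution:
  assumes x0: "x0 = m \<or> x0 \<in> J" and \<phi>: "\<phi> absolutely_integrable_on {0<..<S x0}"
  shows "(\<lambda>x. f x * \<phi> (S x)) absolutely_integrable_on (J \<inter> {x0<..})"
    and "integral (J \<inter> {x0<..}) (\<lambda>x. f x * \<phi> (S x)) = integral {0..S x0} \<phi>"
proof -
  have "(\<lambda>x. \<bar>- f x\<bar> * \<phi> (S x)) absolutely_integrable_on (J \<inter> {x0<..}) \<and>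
       integral (J \<inter> {x0<..}) (\<lambda>x. \<bar>- f x\<bar> * \<phi> (S x)) = integral {0..S x0} \<phi>
     \<longleftrightarrow> \<phi> absolutely_integrable_on (S ` (J \<inter> {x0<..})) \<and> integral (S ` (J \<inter> {x0<..})) \<phi> = integral {0..S x0} \<phi>"
  proof (rule has_absolute_integral_change_of_variables_1')
    show "J \<inter> {x0<..} \<in> sets lebesgue" using open_J by (intro sets.Int) auto
    show "inj_on S (J \<inter> {x0<..})" by (rule inj_on_subset[OF inj_S]) auto
    show "(S has_field_derivative - f x) (at x within J \<inter> {x0<..})" if "x \<in> J \<inter> {x0<..}" for x
      using S_deriv that by (auto intro: has_field_derivative_at_within)
  qed
  then show "(\<lambda>x. f x * \<phi> (S x)) absolutely_integrable_on (J \<inter> {x0<..})"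
    "integral (J \<inter> {x0<..}) (\<lambda>x. f x * \<phi> (S x)) = integral {0..S x0} \<phi>"
    using \<phi> f_nonneg by (simp_all add: S_image_from[OF x0] integral_open_interval_real)
qed

lemma \<theta>_abs_int: "p \<le> a \<Longrightarrow> \<theta> absolutely_integrable_on {0<..<p}"
  using \<theta>_int[of p] pos by (intro nonnegative_absolutely_integrable_1) (auto simp: integrable_on_open_interval_real less_imp_le)

lemma nn_tail: "(\<integral>\<^sup>+x. ennreal (f x) * indicator {s<..} x \<partial>lborel) = ennreal (S s)"
proof -
  have "(\<integral>\<^sup>+x. ennreal (f x) * indicator {s<..} x \<partial>lborel) = (\<integral>\<^sup>+x. ennreal (indicator {s<..} x * f x) \<partial>lborel)"
    by (intro nn_integral_cong) (auto simp: indicator_def)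
  also have "\<dots> = ennreal (S s)"
    unfolding S_def using f_nonneg by (intro nn_integral_eq_integral ind_int) auto
  finally show ?thesis .
qed

lemma nn_iterated_tail:
  assumes x0: "x0 = m \<or> x0 \<in> J"
  shows "(\<integral>\<^sup>+x. ennreal (S x) * indicator {x0<..} x \<partial>lborel) = ennreal (F (S x0))"
proof -
  have abs: "\<theta> absolutely_integrable_on {0<..<S x0}" by (rule \<theta>_abs_int[OF S_le_a])
  have "((\<lambda>x. f x * \<theta> (S x)) has_integral F (S x0)) (J \<inter> {x0<..})"
    using substitution[OF x0 abs] set_lebesgue_integral_eq_integral(1)
    unfolding F_def by (metis has_integral_integrable_integral)
  then have "(S has_integral F (S x0)) (J \<inter> {x0<..})"
    by (rule has_integral_eq[rotated]) (auto simp: \<theta>_S J_def)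
  from nn_integral_has_integral_lebesgue'[OF _ this] S_nonneg
  have "(\<integral>\<^sup>+x. ennreal (S x) * indicator (J \<inter> {x0<..}) x \<partial>lborel) = ennreal (F (S x0))" by simp
  moreover have "ennreal (S x) * indicator (J \<inter> {x0<..}) x = ennreal (S x) * indicator {x0<..} x" for x
    using S_outside[of x] x0 J_gt[of x0] by (cases "x \<in> J") (auto simp: indicator_def)
  ultimately show ?thesis by simp
qed

lemma nn_mean:
  assumes x0: "x0 = m \<or> x0 \<in> J"
  shows "(\<integral>\<^sup>+x. ennreal (x - x0) * ennreal (f x) * indicator {x0<..} x \<partial>lborel) = ennreal (F (S x0))"
  using nn_first_moment[of "\<lambda>x. ennreal (f x)" x0] nn_iterated_tail[OF x0] by (simp add: nn_tail)

lemma nn_square: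
  "(\<integral>\<^sup>+x. ennreal ((x - m)^2) * ennreal (f x) * indicator {m<..} x \<partial>lborel) = ennreal (A a + (F a)^2 / a)"
proof -
  define \<phi> where "\<phi> p = 2 * (F p / p) * \<theta> p" for p
  have "\<phi> integrable_on {0<..<a}"
    using second_moment unfolding \<phi>_def integrable_on_open_interval_real by blast
  moreover have "0 \<le> \<phi> p" if "p \<in> {0<..<a}" for p
    unfolding \<phi>_def using pos[of p] mean_bounds(1)[of p] that by (intro mult_nonneg_nonneg) (auto simp: less_imp_le)
  ultimately have abs: "\<phi> absolutely_integrable_on {0<..<S m}"
    unfolding S_m by (rule nonnegative_absolutely_integrable_1)
  have "integral {0..S m} \<phi> = A a + (F a)^2 / a"
    using second_moment unfolding \<phi>_def S_m by (rule integral_unique)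
  then have "((\<lambda>x. f x * \<phi> (S x)) has_integral (A a + (F a)^2 / a)) J"
    using substitution[OF _ abs] set_lebesgue_integral_eq_integral(1)
    by (metis has_integral_integrable_integral J_m)
  then have "((\<lambda>x. 2 * F (S x)) has_integral (A a + (F a)^2 / a)) J"
    by (rule has_integral_eq[rotated]) (use S_bounds in \<open>force simp: \<theta>_S J_def \<phi>_def\<close>)
  moreover have "0 \<le> 2 * F (S x)" if "x \<in> J" for x
    using F_pos[of "S x"] S_bounds[OF that] by simp
  ultimately have 1: "(\<integral>\<^sup>+x. ennreal (2 * F (S x)) * indicator J x \<partial>lborel) = ennreal (A a + (F a)^2 / a)"
    by (intro nn_integral_has_integral_lebesgue') auto
  have "2 * (\<integral>\<^sup>+x. ennreal (x - s) * ennreal (f x) * indicator {s<..} x \<partial>lborel) * indicator {m<..} s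
      = ennreal (2 * F (S s)) * indicator J s" for s
  proof (cases "s \<in> J")
    case True
    then show ?thesis using nn_mean[of s] J_gt[of s] by (simp add: ennreal_mult')
  next
    case False
    have "f x = 0" if "m < s" "s < x" for x
      using f_anti[of s x] f_nonneg[of x] f_nonneg[of s] that False by (auto simp: J_def)
    then have "(\<integral>\<^sup>+x. ennreal (x - s) * ennreal (f x) * indicator {s<..} x \<partial>lborel) = 0" if "m < s"
      using that by (intro nn_integral_0_iff_AE[THEN iffD2] AE_I2) (auto simp: indicator_def)
    then show ?thesis using False by (auto simp: indicator_def)
  qed
  then show ?thesis using nn_second_moment[of "\<lambda>x. ennreal (f x)" m] 1 by simp
qed

lemma has_mean: "has_bochner_integral lborel (\<lambda>x. (x - m) * f x) (F a)"
proof (rule has_bochner_integral_nn_integral)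
  show "0 \<le> F a" using F_pos[of a] a_pos by simp
  show "AE x in lborel. 0 \<le> (x - m) * f x"
    using f_zero f_nonneg by (intro AE_I2) (metis diff_ge_0_iff_ge linear mult_nonneg_nonneg mult_zero_right order_refl)
  have "(\<integral>\<^sup>+x. ennreal ((x - m) * f x) \<partial>lborel) = (\<integral>\<^sup>+x. ennreal (x - m) * ennreal (f x) * indicator {m<..} x \<partial>lborel)"
    using f_zero f_nonneg by (intro nn_integral_cong) (auto simp: indicator_def ennreal_mult'' not_less)
  then show "(\<integral>\<^sup>+x. ennreal ((x - m) * f x) \<partial>lborel) = ennreal (F a)"
    using nn_mean[of m] by (simp add: S_m)
qed simp

lemma has_square: "has_bochner_integral lborel (\<lambda>x. (x - m)^2 * f x) (A a + (F a)^2 / a)"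
proof (rule has_bochner_integral_nn_integral)
  show "0 \<le> A a + (F a)^2 / a" using A_pos[of a] a_pos by simp
  show "AE x in lborel. 0 \<le> (x - m)^2 * f x" using f_nonneg by simp
  have "(\<integral>\<^sup>+x. ennreal ((x - m)^2 * f x) \<partial>lborel) = (\<integral>\<^sup>+x. ennreal ((x - m)^2) * ennreal (f x) * indicator {m<..} x \<partial>lborel)"
    using f_zero f_nonneg by (intro nn_integral_cong) (auto simp: indicator_def ennreal_mult'' not_less)
  then show "(\<integral>\<^sup>+x. ennreal ((x - m)^2 * f x) \<partial>lborel) = ennreal (A a + (F a)^2 / a)"
    using nn_square by simp
qed simp

lemma has_entropy: "has_bochner_integral lborel (\<lambda>x. f x * ln (f x)) (a * ln a - a - L a)"
proof -
  define \<phi> where "\<phi> p = ln p - ln (\<theta> p)" for p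
  have ln_abs: "ln absolutely_integrable_on {0<..<a}"
  proof (rule dominated_absolutely_integrable_interval(1)[where g = "\<lambda>x. \<bar>ln a\<bar> + (ln a - ln x)"])
    show "continuous_on {0<..<a} ln" by (intro continuous_intros) auto
    show "(\<lambda>x. \<bar>ln a\<bar> + (ln a - ln x)) integrable_on {0..a}"
      using has_integral_ln[of a] a_pos by (auto intro!: integrable_add integrable_diff integrable_const_ivl)
    show "\<bar>ln x\<bar> \<le> \<bar>ln a\<bar> + (ln a - ln x)" if "0 < x" "x < a" for x
      using ln_less_cancel_iff[of x a] that by linarith
  qed
  have abs: "\<phi> absolutely_integrable_on {0<..<S m}"
    unfolding \<phi>_def S_m by (intro set_integral_diff ln_abs ln_\<theta>_abs) simp
  have "(\<phi> has_integral (a * ln a - a) - L a) {0..a}"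
    unfolding \<phi>_def L_def using a_pos by (intro has_integral_diff has_integral_ln integrable_integral ln_\<theta>_abs) auto
  then have int: "integral {0..S m} \<phi> = a * ln a - a - L a" unfolding S_m by (rule integral_unique)
  have eq: "f x * \<phi> (S x) = f x * ln (f x)" if "x \<in> J" for x
    using that S_bounds[OF that] by (auto simp: \<phi>_def \<theta>_S J_def ln_div)
  have "(\<lambda>x. f x * \<phi> (S x)) absolutely_integrable_on J" "integral J (\<lambda>x. f x * \<phi> (S x)) = a * ln a - a - L a"
    using substitution[OF _ abs] int by (simp_all add: J_m)
  moreover have "integral J (\<lambda>x. f x * \<phi> (S x)) = integral J (\<lambda>x. f x * ln (f x))"
    using eq by (rule Henstock_Kurzweil_Integration.integral_cong)
  ultimately have 1: "(\<lambda>x. f x * ln (f x)) absolutely_integrable_on J" "integral J (\<lambda>x. f x * ln (f x)) = a * ln a - a - L a"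
    using eq by (simp_all cong: set_integrable_cong)
  have ind: "indicator J x * (f x * ln (f x)) = f x * ln (f x)" for x
    using f_nonneg[of x] by (auto simp: indicator_def J_def not_less)
  have "integrable lebesgue (\<lambda>x. f x * ln (f x))" "(\<integral>x. f x * ln (f x) \<partial>lebesgue) = a * ln a - a - L a"
    using 1 set_lebesgue_integral_eq_integral(2)[OF 1(1)] by (simp_all add: set_integrable_def set_lebesgue_integral_def ind)
  then show ?thesis
    by (simp add: has_bochner_integral_iff integrable_completion integral_completion)
qed

end

section \<open>Variance and entropy of log-concave densities\<close>

context decreasing_log_concave begin

text \<open>The entropy of the law with density proportional to \<open>f\<close>, rescaled so that its density has peak 1;
  this makes the two halves of a density comparable.\<close>
definition "h = 1 + L a / a - ln (\<theta> a)"

lemma h_range: "0 \<le> h" "h \<le> 1"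
proof -
  have "ln (\<theta> a) - 1 \<le> L a / a" using L_lower a_pos by (simp add: field_simps)
  then show "0 \<le> h" by (simp add: h_def)
  have "L a / a \<le> ln (\<theta> a)" using L_upper a_pos by (simp add: field_simps)
  then show "h \<le> 1" by (simp add: h_def)
qed

lemma L_a: "L a = a * (h - 1 + ln a - ln peak)"
  using a_pos peak_pos by (simp add: h_def \<theta>_a ln_div)

lemma has_entropy_peak: "has_bochner_integral lborel (\<lambda>x. f x * ln (f x)) (a * (ln peak - h))"
proof -
  have "a * ln a - a - L a = a * (ln peak - h)" unfolding L_a by (simp add: algebra_simps)
  then show ?thesis using has_entropy by simp
qed

lemma A_le: "A a \<le> a^3 * exp (2 * h - 2) / peak^2"
proof -
  have "2 * L a / a = (2 * h - 2) + (2 * ln a - 2 * ln peak)" using a_pos by (simp add: L_a field_simps)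
  then have "exp (2 * L a / a) = exp (2 * h - 2) * (exp (2 * ln a - 2 * ln peak))" by (simp only: exp_add)
  also have "exp (2 * ln a - 2 * ln peak) = a^2 / peak^2"
    using a_pos peak_pos by (simp add: exp_diff exp_double)
  finally have e: "exp (2 * L a / a) = exp (2 * h - 2) * (a^2 / peak^2)" .
  have "a * (exp (2 * h - 2) * (a^2 / peak^2)) = a^3 * exp (2 * h - 2) / peak^2"
    by (simp add: power2_eq_square power3_eq_cube)
  then show ?thesis using variance_le unfolding e by (simp only:)
qed

lemma mean_le_h: "0 \<le> F a / a" "F a / a \<le> a * (1 + h) / 2 / peak"
proof -
  show "0 \<le> F a / a" using mean_bounds(1)[of a] a_pos by simp
  have "1 + h = 2 + L a / a - ln (\<theta> a)" by (simp add: h_def)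
  then have "2 * F a / a \<le> a / peak * (1 + h)" using F_le unfolding \<theta>_a by (simp only:)
  then show "F a / a \<le> a * (1 + h) / 2 / peak" by simp
qed

text \<open>Identifies the peaks of the two halves of a density with its value at the mode.\<close>
lemma peak_eqI:
  assumes "\<And>x. f x \<le> B" and "\<And>C. (\<And>x. m < x \<Longrightarrow> f x \<le> C) \<Longrightarrow> B \<le> C"
  shows "peak = B"
proof (rule antisym)
  show "peak \<le> B" unfolding peak_def using J_ne assms(1) by (intro cSUP_least) auto
  show "B \<le> peak"
  proof (rule assms(2))
    fix x
    show "f x \<le> peak"
      using f_le_peak[of x] peak_pos f_nonneg[of x] by (cases "x \<in> J") (auto simp: J_def not_less intro: less_imp_le)
  qed
qed

end

locale log_concave_density =
  fixes f :: "real \<Rightarrow> real"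
  assumes f_integrable: "integrable lborel f"
    and f_nonneg: "0 \<le> f x"
    and f_lc: "0 \<le> u \<Longrightarrow> 0 \<le> v \<Longrightarrow> u + v = 1 \<Longrightarrow> f x powr u * f y powr v \<le> f (u * x + v * y)"
    and open_support: "open {x. 0 < f x}"
    and mass: "(\<integral>x. f x \<partial>lborel) = 1"
begin

lemma reflect: "log_concave_density (\<lambda>x. f (- x))"
proof
  show "integrable lborel (\<lambda>x. f (- x))"
    using lborel_integrable_real_affine[OF f_integrable, of "-1" 0] by simp
  show "(\<integral>x. f (- x) \<partial>lborel) = 1"
    using lborel_integral_real_affine[of "-1" f 0] mass by simp
  show "f (- x) powr u * f (- y) powr v \<le> f (- (u * x + v * y))" if "0 \<le> u" "0 \<le> v" "u + v = 1" for u v x y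
    using f_lc[OF that, of "-x" "-y"] by simp
  have "open (uminus -` {x. 0 < f x})" by (intro open_vimage open_support continuous_intros)
  then show "open {x. 0 < f (- x)}" by (simp add: vimage_def)
qed (rule f_nonneg)

text \<open>Unimodality: the minimum \<open>c\<close> of the two end values satisfies \<open>c\<^sup>u c\<^sup>v = c\<close>.\<close>
lemma between: assumes "x \<le> z" "z \<le> y" shows "min (f x) (f y) \<le> f z"
proof (cases "x = y")
  case False
  define u where "u = (y - z) / (y - x)"
  define v where "v = (z - x) / (y - x)"
  have uv: "0 \<le> u" "0 \<le> v" "u + v = 1" "u * x + v * y = z"
  proof -
    have yx: "0 < y - x" using assms False by simp
    then show "0 \<le> u" "0 \<le> v" using assms by (auto simp: u_def v_def)
    have "u + v = (y - x) / (y - x)" by (simp add: u_def v_def flip: add_divide_distrib)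
    then show "u + v = 1" using yx by simp
    have "u * x + v * y = ((y - z) * x + (z - x) * y) / (y - x)" by (simp add: u_def v_def add_divide_distrib)
    also have "(y - z) * x + (z - x) * y = z * (y - x)" by (simp add: algebra_simps)
    finally show "u * x + v * y = z" using yx by simp
  qed
  define c where "c = min (f x) (f y)"
  have c: "0 \<le> c" "c \<le> f x" "c \<le> f y" using f_nonneg by (auto simp: c_def)
  have "c powr u * c powr v \<le> f x powr u * f y powr v"
    using c uv by (intro mult_mono powr_mono2) auto
  moreover have "c powr u * c powr v = c" using uv c by (cases "c = 0") (simp_all flip: powr_add)
  ultimately show ?thesis using f_lc[OF uv(1-3), of x y] uv(4) by (simp add: c_def)
qed (use assms in auto)

text \<open>Both \<open>x + t\<close> and \<open>y\<close> lie between \<open>x\<close> and \<open>y + t\<close>, with interchanged weights, so the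
  product of the two instances of log-concavity gives the claim.\<close>
lemma shift: assumes "x \<le> y" "0 \<le> t" shows "f x * f (y + t) \<le> f (x + t) * f y"
proof (cases "y + t = x")
  case True
  then have "y = x" "t = 0" using assms by auto
  then show ?thesis by simp
next
  case False
  then have w: "0 < y + t - x" using assms by simp
  define u where "u = (y - x) / (y + t - x)"
  define v where "v = t / (y + t - x)"
  have "u + v = (y + t - x) / (y + t - x)" by (simp add: u_def v_def flip: add_divide_distrib)
  then have uv: "0 \<le> u" "0 \<le> v" "u + v = 1" using assms w by (auto simp: u_def v_def)
  have e1: "u * x + v * (y + t) = x + t" and e2: "v * x + u * (y + t) = y"
  proof -
    have u: "u = 1 - v" using uv by simp
    have v: "v * (y + t - x) = t" using w by (simp add: v_def)
    show "u * x + v * (y + t) = x + t" using v unfolding u by (simp add: algebra_simps)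
    show "v * x + u * (y + t) = y" using v unfolding u by (simp add: algebra_simps)
  qed
  have split: "c powr u * c powr v = c" if "0 \<le> c" for c :: real
    using uv that by (cases "c = 0") (simp_all flip: powr_add)
  have "f x * f (y + t) = (f x powr u * f x powr v) * (f (y + t) powr u * f (y + t) powr v)"
    by (simp only: split f_nonneg)
  also have "\<dots> = (f x powr u * f (y + t) powr v) * (f x powr v * f (y + t) powr u)"
    by (simp only: mult_ac)
  also have "\<dots> \<le> f (x + t) * f y"
  proof (rule mult_mono)
    show "f x powr u * f (y + t) powr v \<le> f (x + t)" using f_lc[OF uv, of x "y + t"] unfolding e1 .
    have "v + u = 1" using uv by simp
    from f_lc[OF uv(2,1) this, of x "y + t"] show "f x powr v * f (y + t) powr u \<le> f y" unfolding e2 .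
  qed (use f_nonneg in auto)
  finally show ?thesis .
qed

lemma convex_support: "convex {x. 0 < f x}"
proof (rule convexI)
  fix x y u v :: real assume "x \<in> {x. 0 < f x}" "y \<in> {x. 0 < f x}" and uv: "0 \<le> u" "0 \<le> v" "u + v = 1"
  then have "0 < f x powr u * f y powr v" by simp
  then show "u *\<^sub>R x + v *\<^sub>R y \<in> {x. 0 < f x}" using f_lc[OF uv, of x y] by simp
qed

lemma f_cont: "continuous_on {x. 0 < f x} f"
proof -
  have "convex_on {x. 0 < f x} (\<lambda>x. - ln (f x))"
  proof (rule convex_onI[OF _ convex_support])
    fix t x y :: real assume t: "0 < t" "t < 1" and xy: "x \<in> {x. 0 < f x}" "y \<in> {x. 0 < f x}"
    then have "ln (f x powr (1 - t) * f y powr t) \<le> ln (f ((1 - t) * x + t * y))"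
      using f_lc[of "1 - t" t x y] by (intro ln_mono) auto
    then show "- ln (f ((1 - t) *\<^sub>R x + t *\<^sub>R y)) \<le> (1 - t) * - ln (f x) + t * - ln (f y)"
      using xy by (simp add: ln_mult ln_powr)
  qed
  then have "continuous_on {x. 0 < f x} (\<lambda>x. - ln (f x))"
    by (rule convex_on_continuous[OF open_support])
  then have "continuous_on {x. 0 < f x} (\<lambda>x. exp (- (- ln (f x))))"
    by (rule continuous_on_exp[OF continuous_on_minus])
  then show ?thesis by (rule continuous_on_eq) auto
qed

lemma right_half:
  assumes anti: "\<And>x y. m < x \<Longrightarrow> x \<le> y \<Longrightarrow> f y \<le> f x" and ex: "m < x0" "0 < f x0"
  shows "decreasing_log_concave (\<lambda>x. indicator {m<..} x * f x) m"
proof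
  have set: "{x. 0 < indicator {m<..} x * f x} = {x. 0 < f x} \<inter> {m<..}"
    by (auto simp: indicator_def split: if_splits)
  show "open {x. 0 < indicator {m<..} x * f x}"
    unfolding set using open_support by (intro open_Int) auto
  show "continuous_on {x. 0 < indicator {m<..} x * f x} (\<lambda>x. indicator {m<..} x * f x)"
    unfolding set by (rule continuous_on_eq[OF continuous_on_subset[OF f_cont]]) auto
  show int: "integrable lborel (\<lambda>x. indicator {m<..} x * f x)"
    using integrable_mult_indicator[OF _ f_integrable, of "{m<..}"] by simp
  show "0 < (\<integral>x. indicator {m<..} x * f x \<partial>lborel)"
  proof -
    have "(\<integral>x. indicator {m<..} x * f x \<partial>lborel) \<noteq> 0"
    proof
      assume "(\<integral>x. indicator {m<..} x * f x \<partial>lborel) = 0"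
      then have "AE x in lborel. indicator {m<..} x * f x = 0"
        using integral_nonneg_eq_0_iff_AE[OF int] f_nonneg by simp
      then have "AE x\<in>{m<..<x0} in lborel. False"
      proof eventually_elim
        case (elim x)
        then show ?case using anti[of x x0] ex by auto
      qed
      then have "emeasure lborel {m<..<x0} = 0"
        by (subst (asm) AE_iff_measurable[of "{m<..<x0}"]) auto
      then show False using ex by simp
    qed
    moreover have "0 \<le> (\<integral>x. indicator {m<..} x * f x \<partial>lborel)" using f_nonneg by (intro integral_nonneg_AE) auto
    ultimately show ?thesis by simp
  qed
  show "0 \<le> indicator {m<..} x * f x" for x using f_nonneg by simp
  show "indicator {m<..} x * f x = 0" if "x \<le> m" for x using that by simp
  show "indicator {m<..} y * f y \<le> indicator {m<..} x * f x" if "m < x" "x \<le> y" for x y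
    using anti that by simp
  show "indicator {m<..} x * f x * (indicator {m<..} (y + t) * f (y + t))
      \<le> indicator {m<..} (x + t) * f (x + t) * (indicator {m<..} y * f y)" if "m < x" "x \<le> y" "0 \<le> t" for x y t
    using shift that by simp
qed

end

text \<open>Here \<open>Q - E\<^sup>2\<close> is the variance, computed from moments about an arbitrary point \<open>m\<close>, and \<open>- N\<close> is
  the entropy.\<close>
definition entropy_bounds_variance :: "(real \<Rightarrow> real) \<Rightarrow> bool" where
  "entropy_bounds_variance f \<longleftrightarrow> (\<exists>m E Q N. has_bochner_integral lborel (\<lambda>x. (x - m) * f x) E \<and>
     has_bochner_integral lborel (\<lambda>x. (x - m)^2 * f x) Q \<and>
     has_bochner_integral lborel (\<lambda>x. f x * ln (f x)) N \<and> Q - E^2 \<le> exp (- 2 * N - 2))"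

lemma has_bochner_integral_uminus_arg:
  fixes g :: "real \<Rightarrow> real"
  shows "has_bochner_integral lborel (\<lambda>x. g (- x)) I \<longleftrightarrow> has_bochner_integral lborel g I"
  using lborel_has_bochner_integral_real_affine_iff[of "-1" g I 0] by simp

lemma entropy_bounds_variance_reflect:
  assumes "entropy_bounds_variance (\<lambda>x. f (- x))" shows "entropy_bounds_variance f"
proof -
  obtain m E Q N where *: "has_bochner_integral lborel (\<lambda>x. (x - m) * f (- x)) E"
     "has_bochner_integral lborel (\<lambda>x. (x - m)^2 * f (- x)) Q"
     "has_bochner_integral lborel (\<lambda>x. f (- x) * ln (f (- x))) N" "Q - E^2 \<le> exp (- 2 * N - 2)"
    using assms unfolding entropy_bounds_variance_def by blast
  have "has_bochner_integral lborel (\<lambda>x. - ((- x - m) * f (- (- x)))) (- E)"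
    by (rule has_bochner_integral_minus) (subst has_bochner_integral_uminus_arg[where g = "\<lambda>x. (x - m) * f (- x)"], rule *)
  then have "has_bochner_integral lborel (\<lambda>x. (x - (- m)) * f x) (- E)" by (simp add: algebra_simps)
  moreover have "has_bochner_integral lborel (\<lambda>x. (x - (- m))^2 * f x) Q"
  proof -
    have "(- x - m)^2 = (x - (- m))^2" for x by (simp add: power2_eq_square algebra_simps)
    then show ?thesis using *(2) has_bochner_integral_uminus_arg[of "\<lambda>x. (x - m)^2 * f (- x)" Q] by simp
  qed
  moreover have "has_bochner_integral lborel (\<lambda>x. f x * ln (f x)) N"
    using *(3) has_bochner_integral_uminus_arg[of "\<lambda>x. f (- x) * ln (f (- x))" N] by simp
  ultimately show ?thesis using *(4) unfolding entropy_bounds_variance_def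
    by (intro exI[of _ "-m"] exI[of _ "-E"] exI[of _ Q] exI[of _ N]) simp
qed

context log_concave_density begin

text \<open>A density that decreases on its support has a support bounded from below, since otherwise it would
  be bounded away from 0 on a half-line of infinite length. So it is a single half.\<close>
lemma decreasing_case:
  assumes anti: "\<And>x y. 0 < f x \<Longrightarrow> 0 < f y \<Longrightarrow> x \<le> y \<Longrightarrow> f y \<le> f x"
  shows "entropy_bounds_variance f"
proof -
  define D where "D = {x. 0 < f x}"
  obtain x0 where x0: "0 < f x0"
  proof -
    have "\<exists>x. 0 < f x"
    proof (rule ccontr)
      assume "\<nexists>x. 0 < f x"
      then have "f = (\<lambda>_. 0)" using f_nonneg by (auto simp: not_less order_antisym)
      then show False using mass by simp
    qed
    then show ?thesis using that by blast
  qed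
  have bdd: "bdd_below D"
  proof (rule ccontr)
    assume nb: "\<not> bdd_below D"
    have low: "f x0 \<le> f x" if "x \<le> x0" for x
    proof -
      obtain z where z: "z \<in> D" "z < x" using nb by (meson bdd_belowI2 bdd_below.I not_le)
      have "0 < f x" using between[of z x x0] z x0 that by (auto simp: D_def)
      then show ?thesis using anti x0 that by simp
    qed
    \<comment> \<open>long enough for a mass of at least 2\<close>
    define I where "I = {x0 - 2 / f x0..x0}"
    have "(\<integral>\<^sup>+x. ennreal (f x0) * indicator I x \<partial>lborel) \<le> (\<integral>\<^sup>+x. ennreal (f x) \<partial>lborel)"
      using low by (intro nn_integral_mono) (auto simp: I_def indicator_def ennreal_leI)
    moreover have "(\<integral>\<^sup>+x. ennreal (f x0) * indicator I x \<partial>lborel) = ennreal (f x0) * ennreal (2 / f x0)"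
      using x0 by (simp add: I_def nn_integral_cmult_indicator)
    moreover have "ennreal (f x0) * ennreal (2 / f x0) = 2"
      using x0 by (simp flip: ennreal_mult)
    moreover have "(\<integral>\<^sup>+x. ennreal (f x) \<partial>lborel) = 1"
      using nn_integral_eq_integral[OF f_integrable] f_nonneg mass by simp
    ultimately show False by simp
  qed
  define l where "l = Inf D"
  have out: "f x = 0" if "x \<le> l" for x
  proof (rule ccontr)
    assume "f x \<noteq> 0"
    then have "x \<in> D" using f_nonneg[of x] by (simp add: D_def)
    then obtain e where "0 < e" "ball x e \<subseteq> D" using open_support unfolding D_def by (meson openE)
    then have "x - e/2 \<in> D" "0 < e" by (auto simp: dist_real_def subset_iff)
    then show False using cInf_lower[OF _ bdd, of "x - e/2"] that by (simp add: l_def)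
  qed
  have full: "0 < f x" if "l < x" "x \<le> y" "0 < f y" for x y
  proof -
    obtain z where z: "z \<in> D" "z < x"
    proof -
      have "D \<noteq> {}" using x0 by (auto simp: D_def)
      then show ?thesis using that cInf_lessD[of D x] \<open>l < x\<close> unfolding l_def by blast
    qed
    then show ?thesis using between[of z x y] that by (auto simp: D_def)
  qed
  have eq: "(\<lambda>x. indicator {l<..} x * f x) = f"
    using out by (auto simp: indicator_def fun_eq_iff not_less)
  interpret decreasing_log_concave f l
  proof -
    have "l < x0" using out[of x0] x0 by force
    moreover have "f y \<le> f x" if "l < x" "x \<le> y" for x y
      using anti[of x y] full[of x y] that f_nonneg[of x] f_nonneg[of y] by (cases "f y = 0") force+
    ultimately show "decreasing_log_concave f l" using right_half[of l x0] x0 unfolding eq by blast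
  qed
  have a1: "a = 1" by (simp add: a_def mass)
  have "A a \<le> exp (2 * h - 2) / peak^2" using A_le by (simp add: a1)
  also have "\<dots> = exp (- 2 * (a * (ln peak - h)) - 2)"
  proof -
    have "- 2 * (a * (ln peak - h)) - 2 = (2 * h - 2) - 2 * ln peak" by (simp add: a1 algebra_simps)
    then show ?thesis using peak_pos by (simp add: exp_diff exp_double)
  qed
  finally have "A a + (F a)^2 / a - (F a)^2 \<le> exp (- 2 * (a * (ln peak - h)) - 2)" by (simp add: a1)
  then show ?thesis
    unfolding entropy_bounds_variance_def using has_mean has_square has_entropy_peak by blast
qed

text \<open>A mixture of the two halves with weights \<open>\<alpha>\<close> and \<open>\<beta>\<close>, whose means have distances \<open>E1 / \<alpha>\<close> and
  \<open>E2 / \<beta>\<close> from the mode on opposite sides, has the variance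
  \<open>V1 + V2 + \<alpha> \<beta> (E1 / \<alpha> + E2 / \<beta>)\<^sup>2\<close>, where \<open>V1\<close> and \<open>V2\<close> are the variances of the halves
  multiplied by their weights. Inserting the bounds for the halves gives the left-hand side of
  \<open>two_sided_scalar\<close>, divided by \<open>(e f(m))\<^sup>2\<close>.\<close>
lemma interior_mode_case:
  assumes m: "0 < f m" and max: "\<And>x. f x \<le> f m"
  shows "entropy_bounds_variance f"
proof -
  have anti: "f y \<le> f x" if "m < x" "x \<le> y" for x y using between[of m x y] max[of y] that by simp
  have anti': "f (- y) \<le> f (- x)" if "- m < x" "x \<le> y" for x y
    using between[of "-y" "-x" m] max[of "-y"] that by simp
  obtain e where e: "0 < e" "ball m e \<subseteq> {x. 0 < f x}" using open_support m by (metis mem_Collect_eq openE)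
  then have e': "0 < f (m + e/2)" "0 < f (m - e/2)" by (auto simp: dist_real_def subset_iff)
  interpret reflected: log_concave_density "\<lambda>x. f (- x)" by (rule reflect)
  interpret R: decreasing_log_concave "\<lambda>x. indicator {m<..} x * f x" m
    using right_half[OF anti, of m "m + e/2"] e' e by simp
  interpret L: decreasing_log_concave "\<lambda>x. indicator {- m<..} x * f (- x)" "- m"
    using reflected.right_half[OF anti', of "- m" "- m + e/2"] e' e by simp
  have cont: "isCont f m" using f_cont open_support m by (simp add: continuous_on_eq_continuous_at)
  have M_R: "R.peak = f m"
  proof (rule R.peak_eqI)
    show "indicator {m<..} x * f x \<le> f m" for x using max f_nonneg m by (simp add: indicator_def)
    fix C assume C: "\<And>x. m < x \<Longrightarrow> indicator {m<..} x * f x \<le> C"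
    have "(f \<longlongrightarrow> f m) (at_right m)" using cont by (simp add: continuous_within isCont_def filterlim_at_split)
    then show "f m \<le> C"
      by (rule tendsto_upperbound) (use C in \<open>auto simp: eventually_at_right_field intro!: exI[of _ "m + 1"]\<close>)
  qed
  have M_L: "L.peak = f m"
  proof (rule L.peak_eqI)
    show "indicator {- m<..} x * f (- x) \<le> f m" for x using max f_nonneg m by (simp add: indicator_def)
    fix C assume C: "\<And>x. - m < x \<Longrightarrow> indicator {- m<..} x * f (- x) \<le> C"
    have "(f \<longlongrightarrow> f m) (at_left m)" using cont by (simp add: continuous_within isCont_def filterlim_at_split)
    then show "f m \<le> C"
    proof (rule tendsto_upperbound)
      have "f x \<le> C" if "x < m" for x using C[of "- x"] that by simp
      then show "\<forall>\<^sub>F x in at_left m. f x \<le> C" by (auto simp: eventually_at_left_field intro!: exI[of _ "m - 1"])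
    qed simp
  qed
  have ae: "AE x in lborel. x \<noteq> m" by (rule AE_lborel_singleton)
  define \<alpha> where "\<alpha> = R.a"
  define \<beta> where "\<beta> = L.a"
  have ab: "0 < \<alpha>" "0 < \<beta>" using R.a_pos L.a_pos by (simp_all add: \<alpha>_def \<beta>_def)
  \<comment> \<open>an integrand \<open>G x (f x)\<close> with \<open>G x 0 = 0\<close> is the sum of its restrictions to the halves, up to
    the null set \<open>{m}\<close>\<close>
  have combine: "has_bochner_integral lborel (\<lambda>x. G x (f x)) (I1 + I2)"
    if 1: "has_bochner_integral lborel (\<lambda>x. G x (indicator {m<..} x * f x)) I1"
    and 2: "has_bochner_integral lborel (\<lambda>x. G (- x) (indicator {- m<..} x * f (- x))) I2"
    and 0: "\<And>x. G x 0 = 0" and meas: "(\<lambda>x. G x (f x)) \<in> borel_measurable lborel" for G :: "real \<Rightarrow> real \<Rightarrow> real" and I1 I2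
  proof -
    have "has_bochner_integral lborel (\<lambda>x. G x (indicator {- m<..} (- x) * f x)) I2"
      using 2 has_bochner_integral_uminus_arg[of "\<lambda>x. G x (indicator {- m<..} (- x) * f x)" I2] by simp
    from has_bochner_integral_add[OF 1 this] show ?thesis
    proof (rule has_bochner_integral_cong_AE[THEN iffD1, rotated -1])
      show "AE x in lborel. G x (indicator {m<..} x * f x) + G x (indicator {- m<..} (- x) * f x) = G x (f x)"
        using ae by eventually_elim (auto simp: indicator_def 0)
    qed (use meas has_bochner_integral_add[OF 1 \<open>has_bochner_integral lborel (\<lambda>x. G x (indicator {- m<..} (- x) * f x)) I2\<close>]
        in \<open>auto simp: has_bochner_integral_iff borel_measurable_integrable\<close>)
  qed
  have [measurable]: "f \<in> borel_measurable borel" using borel_measurable_integrable[OF f_integrable] by simp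
  have "has_bochner_integral lborel f (\<alpha> + \<beta>)"
    using combine[of "\<lambda>x y. y" \<alpha> \<beta>] R.f_integrable L.f_integrable by (simp add: has_bochner_integral_iff R.a_def L.a_def \<alpha>_def \<beta>_def)
  then have ab1: "\<alpha> + \<beta> = 1" using mass by (simp add: has_bochner_integral_iff)
  define E1 where "E1 = R.F \<alpha>"
  define E2 where "E2 = L.F \<beta>"
  define V1 where "V1 = R.A \<alpha>"
  define V2 where "V2 = L.A \<beta>"
  have I1: "has_bochner_integral lborel (\<lambda>x. (x - m) * f x) (E1 + - E2)"
  proof (rule combine[of "\<lambda>x y. (x - m) * y"])
    show "has_bochner_integral lborel (\<lambda>x. (x - m) * (indicator {m<..} x * f x)) E1"
      using R.has_mean by (simp add: E1_def \<alpha>_def)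
    have "has_bochner_integral lborel (\<lambda>x. - ((x - - m) * (indicator {- m<..} x * f (- x)))) (- E2)"
      unfolding E2_def \<beta>_def by (rule has_bochner_integral_minus[OF L.has_mean])
    moreover have "- ((x - - m) * (indicator {- m<..} x * f (- x))) = (- x - m) * (indicator {- m<..} x * f (- x))" for x
      by (simp add: algebra_simps)
    ultimately show "has_bochner_integral lborel (\<lambda>x. (- x - m) * (indicator {- m<..} x * f (- x))) (- E2)" by simp
  qed auto
  have I2: "has_bochner_integral lborel (\<lambda>x. (x - m)^2 * f x) ((V1 + E1^2/\<alpha>) + (V2 + E2^2/\<beta>))"
  proof (rule combine[of "\<lambda>x y. (x - m)^2 * y"])
    show "has_bochner_integral lborel (\<lambda>x. (x - m)^2 * (indicator {m<..} x * f x)) (V1 + E1^2/\<alpha>)"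
      using R.has_square by (simp add: E1_def V1_def \<alpha>_def)
    have "(x - - m)^2 = (- x - m)^2" for x by (simp add: power2_eq_square algebra_simps)
    then show "has_bochner_integral lborel (\<lambda>x. (- x - m)^2 * (indicator {- m<..} x * f (- x))) (V2 + E2^2/\<beta>)"
      using L.has_square by (simp add: E2_def V2_def \<beta>_def)
  qed auto
  have I3: "has_bochner_integral lborel (\<lambda>x. f x * ln (f x)) (\<alpha> * (ln (f m) - R.h) + \<beta> * (ln (f m) - L.h))"
    by (rule combine[of "\<lambda>x y. y * ln y"]) (use R.has_entropy_peak L.has_entropy_peak in \<open>auto simp: \<alpha>_def \<beta>_def M_R M_L\<close>)
  have N: "\<alpha> * (ln (f m) - R.h) + \<beta> * (ln (f m) - L.h) = ln (f m) - (\<alpha> * R.h + \<beta> * L.h)"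
  proof -
    have b: "\<beta> = 1 - \<alpha>" using ab1 by simp
    show ?thesis unfolding b by (simp add: algebra_simps)
  qed
  have V1: "V1 \<le> \<alpha>^3 * exp (2 * R.h - 2) / (f m)^2" using R.A_le by (simp add: V1_def \<alpha>_def M_R)
  have V2: "V2 \<le> \<beta>^3 * exp (2 * L.h - 2) / (f m)^2" using L.A_le by (simp add: V2_def \<beta>_def M_L)
  have E1: "0 \<le> E1 / \<alpha>" "E1 / \<alpha> \<le> \<alpha> * (1 + R.h) / 2 / f m"
    using R.mean_le_h unfolding E1_def \<alpha>_def M_R by blast+
  have E2: "0 \<le> E2 / \<beta>" "E2 / \<beta> \<le> \<beta> * (1 + L.h) / 2 / f m"
    using L.mean_le_h unfolding E2_def \<beta>_def M_L by blast+
  define K where "K = \<alpha> * (1 + R.h) / 2 + \<beta> * (1 + L.h) / 2"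
  have "E1 / \<alpha> + E2 / \<beta> \<le> K / f m" using E1 E2 by (simp add: K_def add_divide_distrib)
  then have sq: "(E1 / \<alpha> + E2 / \<beta>)^2 \<le> (K / f m)^2" using E1 E2 by (intro power_mono) auto
  have "(V1 + E1^2/\<alpha>) + (V2 + E2^2/\<beta>) - (E1 + - E2)^2 = V1 + V2 + \<alpha> * \<beta> * (E1 / \<alpha> + E2 / \<beta>)^2"
  proof -
    define x where "x = E1 / \<alpha>"
    define y where "y = E2 / \<beta>"
    have E: "E1 = \<alpha> * x" "E2 = \<beta> * y" using ab by (auto simp: x_def y_def)
    then have "E1^2 / \<alpha> = \<alpha> * x^2" "E2^2 / \<beta> = \<beta> * y^2" using ab by (simp_all add: power2_eq_square)
    moreover have "\<alpha> * x^2 + \<beta> * y^2 - (\<alpha> * x - \<beta> * y)^2 = \<alpha> * \<beta> * (x + y)^2"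
    proof -
      have b: "\<beta> = 1 - \<alpha>" using ab1 by simp
      show ?thesis unfolding b by (simp add: algebra_simps power2_eq_square)
    qed
    ultimately show ?thesis unfolding x_def[symmetric] y_def[symmetric] by (simp add: E)
  qed
  also have "\<dots> \<le> \<alpha>^3 * exp (2 * R.h - 2) / (f m)^2 + \<beta>^3 * exp (2 * L.h - 2) / (f m)^2 + \<alpha> * \<beta> * (K / f m)^2"
    using V1 V2 sq ab by (intro add_mono mult_left_mono) auto
  also have "\<dots> = exp (- 2) / (f m)^2 * (\<alpha>^3 * exp (2 * R.h) + \<beta>^3 * exp (2 * L.h) + \<alpha> * \<beta> * (exp 1 * K)^2)"
  proof -
    have "exp (2 * R.h - 2) = exp (-2) * exp (2 * R.h)" "exp (2 * L.h - 2) = exp (-2) * exp (2 * L.h)"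
      by (simp_all flip: exp_add)
    moreover have "exp (-2) * (exp 1)^2 = (1::real)" by (simp flip: exp_double exp_add)
    then have "K^2 = exp (-2) * (exp 1 * K)^2" by (simp add: power_mult_distrib flip: mult.assoc)
    ultimately show ?thesis by (simp add: power_divide algebra_simps add_divide_distrib)
  qed
  also have "\<dots> \<le> exp (- 2) / (f m)^2 * exp (2 * (\<alpha> * R.h + \<beta> * L.h))"
    unfolding K_def using two_sided_scalar[of \<alpha> \<beta> R.h L.h] ab ab1 R.h_range L.h_range by (intro mult_left_mono) auto
  also have "\<dots> = exp (- 2 * (ln (f m) - (\<alpha> * R.h + \<beta> * L.h)) - 2)"
  proof -
    have "- 2 * (ln (f m) - (\<alpha> * R.h + \<beta> * L.h)) - 2 = - 2 + 2 * (\<alpha> * R.h + \<beta> * L.h) - 2 * ln (f m)" by simp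
    then have "exp (- 2 * (ln (f m) - (\<alpha> * R.h + \<beta> * L.h)) - 2) = exp (-2) * exp (2 * (\<alpha> * R.h + \<beta> * L.h)) / exp (2 * ln (f m))"
      by (simp only: exp_diff exp_add)
    then show ?thesis using m by (simp add: exp_double)
  qed
  finally show ?thesis
    unfolding entropy_bounds_variance_def using I1 I2 I3 unfolding N by blast
qed

text \<open>If \<open>f\<close> both increases and decreases somewhere on its support, unimodality confines its maximum to
  a compact interval inside the support.\<close>
theorem variance_entropy: "entropy_bounds_variance f"
proof -
  define D where "D = {x. 0 < f x}"
  consider (decr) "\<forall>x\<in>D. \<forall>y\<in>D. x \<le> y \<longrightarrow> f y \<le> f x" | (incr) "\<forall>x\<in>D. \<forall>y\<in>D. x \<le> y \<longrightarrow> f x \<le> f y"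
    | (mode) x y x' y' where "x \<in> D" "y \<in> D" "x \<le> y" "f x < f y" "x' \<in> D" "y' \<in> D" "x' \<le> y'" "f y' < f x'"
    by (meson not_le)
  then show ?thesis
  proof cases
    case decr
    then show ?thesis by (intro decreasing_case) (auto simp: D_def)
  next
    case incr
    interpret reflected: log_concave_density "\<lambda>x. f (- x)" by (rule reflect)
    have "entropy_bounds_variance (\<lambda>x. f (- x))"
      by (rule reflected.decreasing_case) (use incr in \<open>auto simp: D_def\<close>)
    then show ?thesis by (rule entropy_bounds_variance_reflect)
  next
    case mode
    define c where "c = min x x'"
    define d where "d = max y y'"
    have cd: "c \<le> d" using mode by (auto simp: c_def d_def)
    have sub: "{c..d} \<subseteq> D"
    proof
      fix z assume "z \<in> {c..d}"
      moreover have "c \<in> D" "d \<in> D" using mode by (auto simp: c_def d_def min_def max_def)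
      ultimately show "z \<in> D" using between[of c z d] by (auto simp: D_def)
    qed
    have "\<exists>m\<in>{c..d}. \<forall>z\<in>{c..d}. f z \<le> f m"
      by (rule continuous_attains_sup) (use cd sub f_cont in \<open>auto simp: D_def intro: continuous_on_subset\<close>)
    then obtain m where m: "m \<in> {c..d}" "\<And>z. z \<in> {c..d} \<Longrightarrow> f z \<le> f m" by blast
    show ?thesis
    proof (rule interior_mode_case)
      show "0 < f m" using m sub by (auto simp: D_def)
      fix z
      consider "z \<in> {c..d}" | "z < c" | "d < z" by fastforce
      then show "f z \<le> f m"
      proof cases
        case 2
        then have "min (f z) (f y) \<le> f x" using mode by (intro between) (auto simp: c_def)
        then have "f z \<le> f x" using mode by auto
        also have "\<dots> \<le> f m" using mode by (intro m) (auto simp: c_def d_def)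
        finally show ?thesis .
      next
        case 3
        then have "min (f x') (f z) \<le> f y'" using mode by (intro between) (auto simp: d_def)
        then have "f z \<le> f y'" using mode by auto
        also have "\<dots> \<le> f m" using mode by (intro m) (auto simp: c_def d_def)
        finally show ?thesis .
      qed (use m in auto)
    qed
  qed
qed

end

section \<open>Random variables and entropy powers\<close>

text \<open>The support of \<open>exp (- V)\<close> is convex, so its boundary is a null set. Dropping the boundary
  gives a density that is continuous on an open support.\<close>
lemma log_concave_rv_density:
  assumes "prob_space M" "log_concave_rv M X"
  obtains f where "log_concave_density f" "distributed M lborel X (\<lambda>x. ennreal (f x))"
proof -
  interpret prob_space M by fact
  obtain V where V: "convex_ext V" and D: "distributed M lborel X (\<lambda>x. exp_ext (- V x))"
    using assms unfolding log_concave_rv_def by blast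
  have V_minf: "V x \<noteq> - \<infinity>" for x using V by (simp add: convex_ext_def)
  have V_conv: "V (u * x + v * y) \<le> ereal u * V x + ereal v * V y" if "0 \<le> u" "0 \<le> v" "u + v = 1" for u v x y
    using V that by (simp add: convex_ext_def)
  define g where "g x = enn2real (exp_ext (- V x))" for x
  have g_real: "g x = exp (- r)" if "V x = ereal r" for x r
    using that by (simp add: g_def)
  have g_inf: "g x = 0" if "V x = \<infinity>" for x using that by (simp add: g_def)
  have g_ennreal: "ennreal (g x) = exp_ext (- V x)" for x
    using V_minf[of x] by (cases "V x") (simp_all add: g_def)
  have g_nonneg: "0 \<le> g x" for x by (simp add: g_def)
  define D where "D = {x. 0 < g x}"
  have D_real: "\<exists>r. V x = ereal r" if "x \<in> D" for x
    using that V_minf[of x] by (cases "V x") (simp_all add: D_def g_inf)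
  have g_lc: "g x powr u * g y powr v \<le> g (u * x + v * y)"
    if xy: "x \<in> D" "y \<in> D" and uv: "0 \<le> u" "0 \<le> v" "u + v = 1" for x y u v
  proof -
    obtain r s where rs: "V x = ereal r" "V y = ereal s" using D_real xy by blast
    have le: "V (u * x + v * y) \<le> ereal (u * r + v * s)" using V_conv[OF uv, of x y] by (simp add: rs)
    then obtain t where t: "V (u * x + v * y) = ereal t"
      using V_minf[of "u * x + v * y"] by (cases "V (u * x + v * y)") auto
    have "exp (- r) powr u * exp (- s) powr v = exp (- (u * r + v * s))"
      by (simp add: exp_powr_real flip: exp_add)
    also have "\<dots> \<le> exp (- t)" using le t by simp
    finally show ?thesis using rs t by (simp add: g_real)
  qed
  have "convex D"
  proof (rule convexI)
    fix x y u v :: real assume xy: "x \<in> D" "y \<in> D" and uv: "0 \<le> u" "0 \<le> v" "u + v = 1"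
    then have "0 < g x powr u * g y powr v" by (simp add: D_def)
    then show "u *\<^sub>R x + v *\<^sub>R y \<in> D" using g_lc[OF xy uv] by (simp add: D_def)
  qed
  define f where "f x = indicator (interior D) x * g x" for x
  have f_nonneg: "0 \<le> f x" for x by (simp add: f_def g_nonneg)
  have supp: "{x. 0 < f x} = interior D"
    using interior_subset[of D] g_nonneg by (auto simp: f_def indicator_def D_def split: if_splits)
  have [measurable]: "(\<lambda>x. exp_ext (- V x)) \<in> borel_measurable borel"
    using distributed_borel_measurable[OF D] by simp
  have [measurable]: "g \<in> borel_measurable borel" unfolding g_def by measurable
  have [measurable]: "f \<in> borel_measurable borel" unfolding f_def by measurable
  have ae: "AE x in lborel. exp_ext (- V x) = ennreal (f x)"
  proof -
    have "frontier D \<in> null_sets lebesgue"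
      using negligible_convex_frontier[OF \<open>convex D\<close>] by (simp add: negligible_iff_null_sets)
    then have "frontier D \<in> null_sets lborel"
      by (subst (asm) null_sets_completion_iff) (auto intro: borel_closed)
    then have "AE x in lborel. x \<notin> frontier D" by (rule AE_not_in)
    then show ?thesis
    proof eventually_elim
      case (elim x)
      have "x \<in> interior D \<or> g x = 0"
        using elim closure_subset[of D] g_nonneg[of x] by (auto simp: frontier_def D_def less_le)
      then show ?case by (auto simp: f_def indicator_def g_ennreal[symmetric])
    qed
  qed
  have Df: "distributed M lborel X (\<lambda>x. ennreal (f x))"
    using D by (subst (asm) distributed_cong_density[OF ae]) (auto intro: distributed_borel_measurable[OF D])
  have nn: "(\<integral>\<^sup>+x. ennreal (f x) \<partial>lborel) = 1"
    using distributed_nn_integral[OF Df, of "\<lambda>_. 1"] emeasure_space_1 by simp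
  have bi: "has_bochner_integral lborel f 1"
    by (rule has_bochner_integral_nn_integral) (use f_nonneg nn in auto)
  have "log_concave_density f"
  proof
    show "integrable lborel f" "(\<integral>x. f x \<partial>lborel) = 1" using bi by (simp_all add: has_bochner_integral_iff)
    show "open {x. 0 < f x}" by (simp add: supp)
    fix u v x y :: real assume uv: "0 \<le> u" "0 \<le> v" "u + v = 1"
    show "f x powr u * f y powr v \<le> f (u * x + v * y)"
    proof (cases "x \<in> interior D \<and> y \<in> interior D")
      case True
      then have "u * x + v * y \<in> interior D"
        using convexD[OF convex_interior[OF \<open>convex D\<close>], of x y u v] uv by simp
      moreover have "x \<in> D" "y \<in> D" using True interior_subset by blast+
      ultimately show ?thesis using True g_lc[OF _ _ uv, of x y] by (simp add: f_def)
    next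
      case False
      then have "f x = 0 \<or> f y = 0" by (auto simp: f_def)
      then show ?thesis using f_nonneg by auto
    qed
  qed (rule f_nonneg)
  then show ?thesis using Df that by blast
qed

lemma density_entropy_integrable:
  assumes int: "integrable lborel (\<lambda>x. f x * ln (f x))"
  shows "density_entropy f = ereal (- (\<integral>x. f x * ln (f x) \<partial>lborel))"
proof -
  have "(\<integral>\<^sup>+ x. ennreal (f x * ln (f x)) \<partial>lborel) \<noteq> \<infinity>" "(\<integral>\<^sup>+ x. ennreal (- (f x * ln (f x))) \<partial>lborel) \<noteq> \<infinity>"
    using int by (auto simp: real_integrable_def)
  then show ?thesis
    unfolding density_entropy_def real_lebesgue_integral_def[OF int]
    by (cases "\<integral>\<^sup>+ x. ennreal (f x * ln (f x)) \<partial>lborel"; cases "\<integral>\<^sup>+ x. ennreal (- (f x * ln (f x))) \<partial>lborel")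
      (auto simp: enn2ereal_ennreal)
qed

lemma log_concave_variance_le:
  assumes "prob_space M" "log_concave_rv M X"
  obtains H where "X \<in> borel_measurable M" "integrable M X" "integrable M (\<lambda>\<omega>. (X \<omega>)^2)"
    "diff_entropy M X = ereal H" "prob_space.variance M X \<le> exp (2 * H - 2)"
proof -
  interpret prob_space M by fact
  obtain f where lc: "log_concave_density f" and D: "distributed M lborel X (\<lambda>x. ennreal (f x))"
    using log_concave_rv_density[OF assms] by blast
  interpret log_concave_density f by (rule lc)
  have X: "X \<in> borel_measurable M" using distributed_measurable[OF D] by simp
  obtain m E Q N where b: "has_bochner_integral lborel (\<lambda>x. (x - m) * f x) E"
     "has_bochner_integral lborel (\<lambda>x. (x - m)^2 * f x) Q"
     "has_bochner_integral lborel (\<lambda>x. f x * ln (f x)) N" "Q - E^2 \<le> exp (- 2 * N - 2)"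
    using variance_entropy unfolding entropy_bounds_variance_def by blast
  have iE: "integrable M (\<lambda>\<omega>. X \<omega> - m)" and E: "expectation (\<lambda>\<omega>. X \<omega> - m) = E"
    using distributed_integrable[OF D, of "\<lambda>x. x - m"] distributed_integral[OF D, of "\<lambda>x. x - m"] b(1) f_nonneg
    by (simp_all add: has_bochner_integral_iff mult.commute)
  have iQ: "integrable M (\<lambda>\<omega>. (X \<omega> - m)^2)" and Q: "expectation (\<lambda>\<omega>. (X \<omega> - m)^2) = Q"
    using distributed_integrable[OF D, of "\<lambda>x. (x - m)^2"] distributed_integral[OF D, of "\<lambda>x. (x - m)^2"] b(2) f_nonneg
    by (simp_all add: has_bochner_integral_iff mult.commute)
  have iX: "integrable M X" using Bochner_Integration.integrable_add[OF iE, of "\<lambda>_. m"] by simp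
  have "integrable M (\<lambda>\<omega>. (X \<omega> - m)^2 + 2 * m * X \<omega> - m^2)" using iQ iX by simp
  moreover have "(X \<omega> - m)^2 + 2 * m * X \<omega> - m^2 = (X \<omega>)^2" for \<omega> by (simp add: power2_eq_square algebra_simps)
  ultimately have iX2: "integrable M (\<lambda>\<omega>. (X \<omega>)^2)" by simp
  have "variance X = variance (\<lambda>\<omega>. X \<omega> - m)"
    using iX by (simp add: prob_space)
  also have "\<dots> = Q - E^2" using variance_eq[OF iE iQ] by (simp add: E Q)
  finally have "variance X \<le> exp (2 * (- N) - 2)" using b(4) by simp
  moreover have "diff_entropy M X = ereal (- N)"
    using diff_entropy_distributed[OF D f_nonneg] density_entropy_integrable[of f] b(3)
    by (simp add: has_bochner_integral_iff)
  ultimately show ?thesis using that X iX iX2 by blast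
qed

lemma exp_ext_mono: "x \<le> y \<Longrightarrow> exp_ext x \<le> exp_ext y"
  by (cases x; cases y) (auto intro: ennreal_leI)

text \<open>Gibbs' inequality against the Gaussian density \<open>\<phi>\<close> with the same mean and variance: pointwise
  \<open>- g ln g \<le> - g ln \<phi> + \<phi> - g\<close>, and the right-hand side \<open>b\<close> is integrable with integral
  \<open>ln (2 pi e v) / 2\<close>. This also shows that the positive part of \<open>- g ln g\<close> has a finite integral, so
  the entropy is well defined, possibly as \<open>-\<infinity>\<close>.\<close>
lemma entropy_power_le_variance:
  fixes Z :: "'a \<Rightarrow> real"
  assumes "prob_space M" and iZ: "integrable M Z" and iZ2: "integrable M (\<lambda>\<omega>. (Z \<omega>)^2)"
  shows "entropy_power M Z \<le> ennreal (prob_space.variance M Z)"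
proof (cases "\<exists>f. distributed M lborel Z f")
  case False
  then show ?thesis by (simp add: entropy_power_def diff_entropy_def)
next
  case True
  interpret prob_space M by fact
  obtain f where D: "distributed M lborel Z f" using True by blast
  have [measurable]: "f \<in> borel_measurable lborel" using distributed_borel_measurable[OF D] .
  have [measurable]: "Z \<in> borel_measurable M" using iZ by simp
  define g where "g x = enn2real (f x)" for x
  have g_nonneg: "0 \<le> g x" for x by (simp add: g_def)
  have [measurable]: "g \<in> borel_measurable borel" unfolding g_def by measurable
  have f1: "(\<integral>\<^sup>+x. f x \<partial>lborel) = 1"
    using distributed_nn_integral[OF D, of "\<lambda>_. 1"] emeasure_space_1 by simp
  have "AE x in lborel. f x \<noteq> \<infinity>" by (rule nn_integral_PInf_AE) (simp_all add: f1)
  then have "AE x in lborel. f x = ennreal (g x)" by eventually_elim (simp add: g_def top.not_eq_extremum)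
  then have Dg: "distributed M lborel Z (\<lambda>x. ennreal (g x))"
    using D by (subst (asm) distributed_cong_density) auto
  define \<mu> where "\<mu> = expectation Z"
  define v where "v = variance Z"
  have iv: "integrable M (\<lambda>\<omega>. (Z \<omega> - \<mu>)^2)"
  proof -
    have "integrable M (\<lambda>\<omega>. (Z \<omega>)^2 - 2 * \<mu> * Z \<omega> + \<mu>^2)" using iZ iZ2 by simp
    moreover have "(Z \<omega>)^2 - 2 * \<mu> * Z \<omega> + \<mu>^2 = (Z \<omega> - \<mu>)^2" for \<omega> by (simp add: power2_eq_square algebra_simps)
    ultimately show ?thesis by simp
  qed
  have v0: "0 < v"
  proof (rule ccontr)
    assume "\<not> 0 < v"
    then have "v = 0" using variance_positive[of Z] by (simp add: v_def)
    then have "AE \<omega> in M. (Z \<omega> - \<mu>)^2 = 0"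
      using integral_nonneg_eq_0_iff_AE[OF iv] by (simp add: v_def \<mu>_def)
    then have "AE \<omega> in M. Z \<omega> \<in> {\<mu>}" by simp
    then have "emeasure M (Z -` {\<mu>} \<inter> space M) = 1"
      by (intro emeasure_eq_1_AE) auto
    moreover have "emeasure M (Z -` {\<mu>} \<inter> space M) = (\<integral>\<^sup>+x. f x * indicator {\<mu>} x \<partial>lborel)"
      by (rule distributed_emeasure[OF D]) simp
    moreover have "(\<integral>\<^sup>+x. f x * indicator {\<mu>} x \<partial>lborel) = 0"
      by (subst nn_integral_0_iff_AE) (use AE_lborel_singleton[of \<mu>] in \<open>auto simp: indicator_def\<close>)
    ultimately show False by simp
  qed
  define \<sigma> where "\<sigma> = sqrt v"
  have \<sigma>: "0 < \<sigma>" "\<sigma>^2 = v" using v0 by (auto simp: \<sigma>_def)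
  define \<phi> where "\<phi> = normal_density \<mu> \<sigma>"
  have \<phi>_pos: "0 < \<phi> x" for x unfolding \<phi>_def using \<sigma>(1) by (rule normal_density_pos)
  have \<phi>_int: "has_bochner_integral lborel \<phi> 1"
    using \<sigma> by (simp add: \<phi>_def has_bochner_integral_iff)
  define c where "c = ln (2 * pi * v) / 2"
  have ln\<phi>: "- ln (\<phi> x) = c + (x - \<mu>)^2 / (2 * v)" for x
    using v0 by (simp add: \<phi>_def normal_density_def \<sigma> c_def ln_mult ln_div ln_sqrt)
  have g_int: "has_bochner_integral lborel g 1"
  proof (rule has_bochner_integral_nn_integral)
    show "(\<integral>\<^sup>+x. ennreal (g x) \<partial>lborel) = ennreal 1"
      using distributed_nn_integral[OF Dg, of "\<lambda>_. 1"] emeasure_space_1 by simp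
  qed (simp_all add: g_nonneg)
  have g_sq: "has_bochner_integral lborel (\<lambda>x. g x * (x - \<mu>)^2) v"
    using distributed_integrable[OF Dg, of "\<lambda>x. (x - \<mu>)^2"] distributed_integral[OF Dg, of "\<lambda>x. (x - \<mu>)^2"] iv
    by (simp add: has_bochner_integral_iff g_nonneg v_def \<mu>_def)
  define b where "b x = c * g x + g x * (x - \<mu>)^2 / (2 * v) + \<phi> x - g x" for x
  have b_int: "has_bochner_integral lborel b (c + 1/2)"
  proof -
    have "has_bochner_integral lborel b (c * 1 + v / (2 * v) + 1 - 1)"
      unfolding b_def
      by (intro has_bochner_integral_diff has_bochner_integral_add has_bochner_integral_mult_right
          has_bochner_integral_divide_zero g_int g_sq \<phi>_int)
    then show ?thesis using v0 by (simp add: add.commute)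
  qed
  have pt: "- (g x * ln (g x)) \<le> b x" for x
  proof (cases "g x = 0")
    case False
    then have g0: "0 < g x" using g_nonneg[of x] by simp
    have "ln (\<phi> x / g x) \<le> \<phi> x / g x - 1" using g0 \<phi>_pos[of x] by (intro ln_le_minus_one) auto
    then have "g x * ln (\<phi> x / g x) \<le> g x * (\<phi> x / g x - 1)" using g0 by (intro mult_left_mono) auto
    also have "\<dots> = \<phi> x - g x" using g0 by (simp add: field_simps)
    finally have "g x * (ln (\<phi> x) - ln (g x)) \<le> \<phi> x - g x" using g0 \<phi>_pos[of x] by (simp add: ln_div)
    moreover have "b x = g x * (- ln (\<phi> x)) + \<phi> x - g x" unfolding ln\<phi> b_def by (simp add: algebra_simps)
    ultimately show ?thesis by (simp add: algebra_simps)
  qed (use \<phi>_pos[of x] in \<open>simp add: b_def\<close>)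
  have ent: "density_entropy g \<le> ereal (c + 1/2)"
  proof (cases "integrable lborel (\<lambda>x. g x * ln (g x))")
    case True
    have "(\<integral>x. - (g x * ln (g x)) \<partial>lborel) \<le> (\<integral>x. b x \<partial>lborel)"
      using b_int True pt by (intro integral_mono) (auto simp: has_bochner_integral_iff)
    then show ?thesis using b_int by (simp add: density_entropy_integrable[OF True] has_bochner_integral_iff)
  next
    case False
    have "(\<integral>\<^sup>+x. ennreal (- (g x * ln (g x))) \<partial>lborel) \<le> (\<integral>\<^sup>+x. ennreal \<bar>b x\<bar> \<partial>lborel)"
      using pt by (intro nn_integral_mono ennreal_leI) (metis abs_ge_self order_trans)
    also have "\<dots> < \<infinity>"
      using b_int by (simp add: has_bochner_integral_iff integrable_iff_bounded)
    finally have P: "(\<integral>\<^sup>+x. ennreal (- (g x * ln (g x))) \<partial>lborel) < \<infinity>" .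
    then have "(\<integral>\<^sup>+x. ennreal (g x * ln (g x)) \<partial>lborel) = \<infinity>"
      using False by (auto simp: real_integrable_def)
    then show ?thesis using P unfolding density_entropy_def
      by (cases "\<integral>\<^sup>+x. ennreal (- (g x * ln (g x))) \<partial>lborel") (auto simp: enn2ereal_ennreal)
  qed
  have "entropy_power M Z = ennreal (1 / (2 * pi * exp 1)) * exp_ext (2 * density_entropy g)"
    by (simp add: entropy_power_def diff_entropy_distributed[OF Dg g_nonneg])
  also have "\<dots> \<le> ennreal (1 / (2 * pi * exp 1)) * exp_ext (2 * ereal (c + 1/2))"
    using ent by (intro mult_left_mono exp_ext_mono ereal_mult_left_mono) auto
  also have "\<dots> = ennreal (1 / (2 * pi * exp 1) * exp (2 * (c + 1/2)))"
    by (simp flip: ennreal_mult'')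
  also have "exp (2 * (c + 1/2)) = 2 * pi * v * exp 1"
    using v0 by (simp add: c_def exp_add)
  also have "1 / (2 * pi * exp 1) * (2 * pi * v * exp 1) = v" by simp
  finally show ?thesis by (simp add: v_def)
qed

lemma (in prob_space) variance_add_uncorrelated:
  fixes X Y :: "'a \<Rightarrow> real"
  assumes X: "integrable M X" "integrable M (\<lambda>\<omega>. (X \<omega>)^2)"
    and Y: "integrable M Y" "integrable M (\<lambda>\<omega>. (Y \<omega>)^2)"
    and cov: "covariance M X Y = 0"
  shows "integrable M (\<lambda>\<omega>. (X \<omega> + Y \<omega>)^2)" "variance (\<lambda>\<omega>. X \<omega> + Y \<omega>) = variance X + variance Y"
proof -
  have [measurable]: "X \<in> borel_measurable M" "Y \<in> borel_measurable M" using X Y by auto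
  have XY: "integrable M (\<lambda>\<omega>. X \<omega> * Y \<omega>)"
  proof (rule Bochner_Integration.integrable_bound)
    show "integrable M (\<lambda>\<omega>. (X \<omega>)^2 + (Y \<omega>)^2)" using X Y by simp
    have "\<bar>x * y\<bar> \<le> x^2 + y^2" for x y :: real
    proof -
      have "0 \<le> (\<bar>x\<bar> - \<bar>y\<bar>)^2" by simp
      then have "2 * (\<bar>x\<bar> * \<bar>y\<bar>) \<le> x^2 + y^2" by (simp add: power2_diff)
      moreover have "0 \<le> \<bar>x\<bar> * \<bar>y\<bar>" by simp
      ultimately show ?thesis unfolding abs_mult by linarith
    qed
    then show "AE \<omega> in M. norm (X \<omega> * Y \<omega>) \<le> norm ((X \<omega>)^2 + (Y \<omega>)^2)" by simp
  qed simp
  have "(\<lambda>\<omega>. (X \<omega> + Y \<omega>)^2) = (\<lambda>\<omega>. (X \<omega>)^2 + (Y \<omega>)^2 + 2 * (X \<omega> * Y \<omega>))"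
    by (simp add: fun_eq_iff power2_sum)
  then show i2: "integrable M (\<lambda>\<omega>. (X \<omega> + Y \<omega>)^2)" using X Y XY by simp
  define a where "a = expectation X"
  define b where "b = expectation Y"
  have "covariance M X Y = expectation (\<lambda>\<omega>. X \<omega> * Y \<omega> - b * X \<omega> - a * Y \<omega> + a * b)"
    unfolding covariance_def a_def[symmetric] b_def[symmetric] by (simp add: algebra_simps)
  also have "\<dots> = expectation (\<lambda>\<omega>. X \<omega> * Y \<omega>) - a * b"
    using X Y XY by (simp add: prob_space a_def[symmetric] b_def[symmetric])
  finally have c: "expectation (\<lambda>\<omega>. X \<omega> * Y \<omega>) = a * b" using cov by simp
  have "variance (\<lambda>\<omega>. X \<omega> + Y \<omega>) = expectation (\<lambda>\<omega>. (X \<omega> + Y \<omega>)^2) - (a + b)^2"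
    using variance_eq[OF _ i2] X Y by (simp add: a_def b_def)
  also have "expectation (\<lambda>\<omega>. (X \<omega> + Y \<omega>)^2) = expectation (\<lambda>\<omega>. (X \<omega>)^2) + expectation (\<lambda>\<omega>. (Y \<omega>)^2) + 2 * (a * b)"
    using X Y XY by (simp add: power2_sum c mult.assoc)
  finally show "variance (\<lambda>\<omega>. X \<omega> + Y \<omega>) = variance X + variance Y"
    using variance_eq[OF X] variance_eq[OF Y] by (simp add: a_def b_def power2_sum)
qed

theorem corollary2p3:
  fixes M :: "'a measure" and X Y :: "'a \<Rightarrow> real"
  assumes "prob_space M"
    and "log_concave_rv M X"
    and "log_concave_rv M Y"
    and "covariance M X Y = 0"
  shows "entropy_power M (\<lambda>\<omega>. X \<omega> + Y \<omega>)
    \<le> ennreal (2 * pi / exp 1) * (entropy_power M X + entropy_power M Y)"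
proof -
  interpret prob_space M by fact
  obtain H where X: "integrable M X" "integrable M (\<lambda>\<omega>. (X \<omega>)^2)"
    "diff_entropy M X = ereal H" "variance X \<le> exp (2 * H - 2)"
    using log_concave_variance_le[OF assms(1,2)] by blast
  obtain K where Y: "integrable M Y" "integrable M (\<lambda>\<omega>. (Y \<omega>)^2)"
    "diff_entropy M Y = ereal K" "variance Y \<le> exp (2 * K - 2)"
    using log_concave_variance_le[OF assms(1,3)] by blast
  have N: "entropy_power M W = ennreal (exp 1 / (2 * pi) * exp (2 * h - 2))" if "diff_entropy M W = ereal h" for W h
  proof -
    have "entropy_power M W = ennreal (1 / (2 * pi * exp 1) * exp (2 * h))"
      by (simp add: entropy_power_def that flip: ennreal_mult'')
    also have "exp (2 * h) = exp 1 * exp 1 * exp (2 * h - 2)" by (simp flip: exp_add)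
    finally show ?thesis by simp
  qed
  have "entropy_power M (\<lambda>\<omega>. X \<omega> + Y \<omega>) \<le> ennreal (variance (\<lambda>\<omega>. X \<omega> + Y \<omega>))"
    using X Y variance_add_uncorrelated(1)[OF X(1,2) Y(1,2) assms(4)] assms(1)
    by (intro entropy_power_le_variance) auto
  also have "\<dots> \<le> ennreal (exp (2 * H - 2) + exp (2 * K - 2))"
    using variance_add_uncorrelated(2)[OF X(1,2) Y(1,2) assms(4)] X(4) Y(4) by (intro ennreal_leI) simp
  also have "\<dots> = ennreal (2 * pi / exp 1 * (exp 1 / (2 * pi) * exp (2 * H - 2) + exp 1 / (2 * pi) * exp (2 * K - 2)))"
    by (simp add: algebra_simps)
  also have "\<dots> = ennreal (2 * pi / exp 1) * (entropy_power M X + entropy_power M Y)"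
    unfolding N[OF X(3)] N[OF Y(3)]
    by (simp add: ennreal_mult[symmetric] ennreal_plus[symmetric] del: ennreal_plus)
  finally show ?thesis .
qed

end
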